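(* Let $r,m,\ell\ge1$, let $\mathfrak q_1,\dots,\mathfrak q_\ell\in A=\mathbb F_q[T]$ be distinct monic irreducible polynomials of degree $m$, none equal to $T$, and let $\phi$ be the Drinfeld module over $k=\mathbb F_{q^r}$ (with $T\mapsto0$) given by $\phi_T=\tau^r$. Put $R=\mathbb F_{q^r}\{\tau\}$, $Q_i=\mathfrak q_i(\tau^r)$, $\Pi=\prod_iQ_i$, $\mathsf N=\deg_\tau(\Pi)=m\ell r$, let $1\le t\le\ell r$ be an integer and $K=mt$. Let $\varepsilon\in\mathbb Z_{\ge0}$ satisfy $2\varepsilon+t\le\ell r$. Suppose that $\boldsymbol Y=\boldsymbol C+\boldsymbol E\in\operatorname{Mat}_{r\times r}(\mathbb F_{q^m})^\ell$ is received, where $\boldsymbol C=\Theta(\operatorname{CRT}_\Gamma(u))$ is encoded by $u\in R$ with $\deg_\tau(u)<K$ and $\operatorname{wt}_{SR}(\boldsymbol E)\le\varepsilon$. Let $Y\in R$ be the CRT lift of $\Theta^{-1}(\boldsymbol Y)$, with $\deg_\tau(Y)<\mathsf N$. Then the homogeneous key equation $$vY\equiv N\pmod\Pi,\qquad\deg_\tau(v)\le m\varepsilon,\qquad\deg_\tau(N)\le m\varepsilon+K-1,$$ in unknowns $v,N\in R$, has a nonzero solution $(v,N)$, and every nonzero solution satisfies $N=vu$. In particular, $v\ne0$ for every nonzero solution, and left division of $N$ by $v$ recovers $u$.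
   Context: $q$ is a prime power. $R=\mathbb F_{q^r}\{\tau\}$ is the skew polynomial ring with $\tau\alpha=\alpha^q\tau$ for $\alpha\in\mathbb F_{q^r}$; it is Euclidean on both sides, and $\deg_\tau(0)=-\infty$. An element $\sum a_i\tau^i$ acts on an algebraic closure $\overline k$ by $x\mapsto\sum a_ix^{q^i}$. The elements $Q_i$ and $\Pi$ are central in $R$, so $(Q_i)=RQ_i$ and $(\Pi)=R\Pi$ are two-sided ideals; $F\equiv G\pmod\Pi$ means $F-G\in(\Pi)$. Put $\mathcal R_\Gamma=\prod_{i=1}^\ell R/(Q_i)$. The map $\operatorname{CRT}_\Gamma:R/(\Pi)\to\mathcal R_\Gamma$ taking $u$ to its right remainders modulo the $Q_i$ is an isomorphism; the CRT lift of $\boldsymbol y\in\mathcal R_\Gamma$ is the unique $Y\in R$ with $\deg_\tau(Y)<\mathsf N$ and $\operatorname{CRT}_\Gamma(Y)=\boldsymbol y$. Left division of $N$ by $v$ means $N=v\widehat u+\Delta$ with $\deg_\tau(\Delta)<\deg_\tau(v)$ (divisor on the left, quotient $\widehat u$ on the right). The Drinfeld module is $\phi:A\to k\{\tau\}$, $a\mapsto\phi_a=a(\tau^r)$; its endomorphism ring is $R$. $\phi[a]=\{\alpha\in\overline k:\phi_a(\alpha)=0\}$ is an $A$-module via $b\cdot\alpha=\phi_b(\alpha)$, and $\phi[\mathfrak q_i]\cong(A/\mathfrak q_i)^r\cong\mathbb F_{q^m}^r$. Restriction of $u\in R$ to $\phi[\mathfrak q_i]$ induces an isomorphism $\Theta_i:R/(Q_i)\to\operatorname{End}_{A/(\mathfrak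 q_i)}(\phi[\mathfrak q_i])\cong\operatorname{Mat}_{r\times r}(\mathbb F_{q^m})$ (after fixing isomorphisms $A/\mathfrak q_i\cong\mathbb F_{q^m}$ and bases), and $\Theta:\mathcal R_\Gamma\to\operatorname{Mat}_{r\times r}(\mathbb F_{q^m})^\ell$ is $(y_i)_i\mapsto(\Theta_i(y_i))_i$. For a tuple $X=(X_1,\dots,X_\ell)$ of matrices, $\operatorname{wt}_{SR}(X)=\sum_i\operatorname{rk}_{\mathbb F_{q^m}}(X_i)$. *)

theory Defs
  imports
    "HOL-Analysis.Analysis"
    "HOL-Library.Extended_Real"
    "HOL-Algebra.QuotRing"
    "HOL-Algebra.Algebraic_Closure_Type"
begin

unbundle no fps_syntax

section \<open>The skew polynomial ring\<close>

text \<open>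
  A skew polynomial \<open>\<Sum>i. a\<^sub>i \<tau>\<^sup>i\<close> (coefficients on the left) is represented by the ordinary polynomial
  with the same coefficients, so that addition and the coefficient functions are those of
  \<^typ>\<open>'k poly\<close>. Only the multiplication differs: it is the biadditive one with
  \<open>(a \<tau>\<^sup>i) (b \<tau>\<^sup>j) = a b\<^bsup>q\<^sup>i\<^esup> \<tau>\<^sup>i\<^sup>+\<^sup>j\<close>, as forced by \<open>\<tau> b = b\<^sup>q \<tau>\<close>.
\<close>

definition skew_mult :: "nat \<Rightarrow> 'k::field poly \<Rightarrow> 'k poly \<Rightarrow> 'k poly" where
  "skew_mult q F G =
     (\<Sum>i\<le>Polynomial.degree F. \<Sum>j\<le>Polynomial.degree G.
        Polynomial.monom (Polynomial.coeff F i * Polynomial.coeff G j ^ (q ^ i)) (i + j))"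

definition skew_ring :: "nat \<Rightarrow> 'k::field poly ring" where
  "skew_ring q = \<lparr>carrier = UNIV, monoid.mult = skew_mult q, one = 1, ring.zero = 0, add = (+)\<rparr>"

definition deg_tau :: "'k::field poly \<Rightarrow> ereal" where
  "deg_tau F = (if F = 0 then -\<infinity> else ereal (real (Polynomial.degree F)))"

text \<open>Since the ring is not commutative, \<open>Q\<^sub>0 \<cdots> Q\<^sub>l\<^sub>-\<^sub>1\<close> is an ordered product.\<close>

definition skew_prod :: "nat \<Rightarrow> (nat \<Rightarrow> 'k::field poly) \<Rightarrow> nat \<Rightarrow> 'k poly" where
  "skew_prod q Q l = foldr (\<lambda>i F. Q i \<otimes>\<^bsub>skew_ring q\<^esub> F) [0..<l] \<one>\<^bsub>skew_ring q\<^esub>"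

text \<open>
  In the library \<open>PIdl\<^bsub>R\<^esub> P\<close> is the set \<open>R P\<close> of left multiples of \<open>P\<close>; it is a two-sided ideal for
  the central elements \<open>P\<close> it is used with.
\<close>

definition skew_cong :: "nat \<Rightarrow> 'k::field poly \<Rightarrow> 'k poly \<Rightarrow> 'k poly \<Rightarrow> bool" where
  "skew_cong q P F G \<longleftrightarrow> F \<ominus>\<^bsub>skew_ring q\<^esub> G \<in> PIdl\<^bsub>skew_ring q\<^esub> P"

definition is_left_division ::
  "nat \<Rightarrow> 'k::field poly \<Rightarrow> 'k poly \<Rightarrow> 'k poly \<Rightarrow> 'k poly \<Rightarrow> bool" where
  "is_left_division q N v w D \<longleftrightarrow>
     N = (v \<otimes>\<^bsub>skew_ring q\<^esub> w) \<oplus>\<^bsub>skew_ring q\<^esub> D \<and> deg_tau D < deg_tau v"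

section \<open>Chinese remaindering\<close>

definition skew_quot :: "nat \<Rightarrow> 'k::field poly \<Rightarrow> 'k poly set ring" where
  "skew_quot q P = skew_ring q Quot (PIdl\<^bsub>skew_ring q\<^esub> P)"

definition crt_carrier :: "nat \<Rightarrow> (nat \<Rightarrow> 'k::field poly) \<Rightarrow> nat \<Rightarrow> (nat \<Rightarrow> 'k poly set) set" where
  "crt_carrier q Q l = (\<Pi>\<^sub>E i\<in>{..<l}. carrier (skew_quot q (Q i)))"

text \<open>
  Elements of the quotient by \<open>(Q\<^sub>i)\<close> are cosets; the coset of \<open>u\<close> is the one of its right remainder
  modulo \<open>Q\<^sub>i\<close>. The map is given on the skew polynomial ring itself, that is, composed with the
  projection onto the quotient by the product of the \<open>Q\<^sub>i\<close>.
\<close>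

definition crt :: "nat \<Rightarrow> (nat \<Rightarrow> 'k::field poly) \<Rightarrow> nat \<Rightarrow> 'k poly \<Rightarrow> (nat \<Rightarrow> 'k poly set)" where
  "crt q Q l u = (\<lambda>i\<in>{..<l}. PIdl\<^bsub>skew_ring q\<^esub> (Q i) +>\<^bsub>skew_ring q\<^esub> u)"

definition crt_lift :: "nat \<Rightarrow> (nat \<Rightarrow> 'k::field poly) \<Rightarrow> nat \<Rightarrow> (nat \<Rightarrow> 'k poly set) \<Rightarrow> 'k poly" where
  "crt_lift q Q l y = (THE Y. deg_tau Y < deg_tau (skew_prod q Q l) \<and> crt q Q l Y = y)"

section \<open>The Drinfeld module and its torsion\<close>

text \<open>
  The base field with \<open>q\<close> elements is a type \<open>'f\<close> of its own, with an embedding \<open>\<iota>\<close> into the field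
  \<open>'k\<close> with \<open>q\<^sup>r\<close> elements; the ring \<open>A\<close> is \<^typ>\<open>'f poly\<close>. The value at \<open>a\<close> is
  \<open>a(\<tau>\<^sup>r) = \<Sum>j. \<iota>(a\<^sub>j) \<tau>\<^sup>r\<^sup>j\<close>.
\<close>

definition drinfeld :: "('f::field \<Rightarrow> 'k::field) \<Rightarrow> nat \<Rightarrow> 'f poly \<Rightarrow> 'k poly" where
  "drinfeld \<iota> r a =
     (\<Sum>j\<le>Polynomial.degree a. Polynomial.monom (\<iota> (Polynomial.coeff a j)) (r * j))"

definition tau_act :: "nat \<Rightarrow> 'k::field poly \<Rightarrow> 'k alg_closure \<Rightarrow> 'k alg_closure" where
  "tau_act q F x = (\<Sum>i\<le>Polynomial.degree F. to_ac (Polynomial.coeff F i) * x ^ (q ^ i))"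

definition torsion ::
  "nat \<Rightarrow> ('f::field \<Rightarrow> 'k::field) \<Rightarrow> nat \<Rightarrow> 'f poly \<Rightarrow> 'k alg_closure set" where
  "torsion q \<iota> r a = {\<alpha>. tau_act q (drinfeld \<iota> r a) \<alpha> = 0}"

abbreviation type_ring :: "'a::comm_ring_1 ring" where
  "type_ring \<equiv> ring_of_type_algebra"

definition residue_class :: "'f::field poly \<Rightarrow> 'f poly \<Rightarrow> 'f poly set" where
  "residue_class p a = PIdl\<^bsub>type_ring\<^esub> p +>\<^bsub>type_ring\<^esub> a"

definition residue_iso :: "'f::field poly \<Rightarrow> ('f poly set \<Rightarrow> 'e::field) \<Rightarrow> bool" where
  "residue_iso p \<sigma> \<longleftrightarrow> \<sigma> \<in> ring_iso (type_ring Quot (PIdl\<^bsub>type_ring\<^esub> p)) type_ring"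

text \<open>
  The \<open>'e\<close>-vector space structure on the \<open>p\<close>-torsion: \<open>c\<close> acts as any \<open>a\<close> whose residue class
  corresponds to \<open>c\<close> under the chosen isomorphism \<open>\<sigma>\<close> from the residue ring of \<open>p\<close> to \<open>'e\<close>.
\<close>

definition torsion_smult ::
  "nat \<Rightarrow> ('f::field \<Rightarrow> 'k::field) \<Rightarrow> nat \<Rightarrow> 'f poly \<Rightarrow> ('f poly set \<Rightarrow> 'e::field) \<Rightarrow>
   'e \<Rightarrow> 'k alg_closure \<Rightarrow> 'k alg_closure" where
  "torsion_smult q \<iota> r p \<sigma> c \<alpha> = tau_act q (drinfeld \<iota> r (SOME a. \<sigma> (residue_class p a) = c)) \<alpha>"

definition torsion_comb ::
  "nat \<Rightarrow> ('f::field \<Rightarrow> 'k::field) \<Rightarrow> nat \<Rightarrow> 'f poly \<Rightarrow> ('f poly set \<Rightarrow> 'e::field) \<Rightarrow>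
   ('n::finite \<Rightarrow> 'k alg_closure) \<Rightarrow> 'e ^ 'n \<Rightarrow> 'k alg_closure" where
  "torsion_comb q \<iota> r p \<sigma> \<beta> c = (\<Sum>k\<in>UNIV. torsion_smult q \<iota> r p \<sigma> (c $ k) (\<beta> k))"

definition torsion_basis ::
  "nat \<Rightarrow> ('f::field \<Rightarrow> 'k::field) \<Rightarrow> nat \<Rightarrow> 'f poly \<Rightarrow> ('f poly set \<Rightarrow> 'e::field) \<Rightarrow>
   ('n::finite \<Rightarrow> 'k alg_closure) \<Rightarrow> bool" where
  "torsion_basis q \<iota> r p \<sigma> \<beta> \<longleftrightarrow>
     (\<forall>k. \<beta> k \<in> torsion q \<iota> r p) \<and>
     (\<forall>\<alpha>\<in>torsion q \<iota> r p. \<exists>!c. torsion_comb q \<iota> r p \<sigma> \<beta> c = \<alpha>)"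

section \<open>The matrix representation and the sum-rank weight\<close>

definition torsion_coords ::
  "nat \<Rightarrow> ('f::field \<Rightarrow> 'k::field) \<Rightarrow> nat \<Rightarrow> 'f poly \<Rightarrow> ('f poly set \<Rightarrow> 'e::field) \<Rightarrow>
   ('n::finite \<Rightarrow> 'k alg_closure) \<Rightarrow> 'k alg_closure \<Rightarrow> 'e ^ 'n" where
  "torsion_coords q \<iota> r p \<sigma> \<beta> \<alpha> = (THE c. torsion_comb q \<iota> r p \<sigma> \<beta> c = \<alpha>)"

text \<open>
  Column \<open>j\<close> holds the coordinates of the image of \<open>\<beta>\<^sub>j\<close>. All members of a coset of \<open>R \<phi>\<^sub>p\<close>
  restrict to the same endomorphism of the \<open>p\<close>-torsion, so the representative is immaterial.
\<close>

definition Theta_comp ::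
  "nat \<Rightarrow> ('f::field \<Rightarrow> 'k::field) \<Rightarrow> nat \<Rightarrow> 'f poly \<Rightarrow> ('f poly set \<Rightarrow> 'e::field) \<Rightarrow>
   ('n::finite \<Rightarrow> 'k alg_closure) \<Rightarrow> 'k poly set \<Rightarrow> 'e ^ 'n ^ 'n" where
  "Theta_comp q \<iota> r p \<sigma> \<beta> U =
     (\<chi> i j. torsion_coords q \<iota> r p \<sigma> \<beta> (tau_act q (SOME u. u \<in> U) (\<beta> j)) $ i)"

definition Theta ::
  "nat \<Rightarrow> ('f::field \<Rightarrow> 'k::field) \<Rightarrow> nat \<Rightarrow> (nat \<Rightarrow> 'f poly) \<Rightarrow> nat \<Rightarrow>
   (nat \<Rightarrow> 'f poly set \<Rightarrow> 'e::field) \<Rightarrow> (nat \<Rightarrow> 'n::finite \<Rightarrow> 'k alg_closure) \<Rightarrow>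
   (nat \<Rightarrow> 'k poly set) \<Rightarrow> (nat \<Rightarrow> 'e ^ 'n ^ 'n)" where
  "Theta q \<iota> r \<qq> l \<sigma> \<beta> y = (\<lambda>i\<in>{..<l}. Theta_comp q \<iota> r (\<qq> i) (\<sigma> i) (\<beta> i) (y i))"

definition Theta_inv ::
  "nat \<Rightarrow> ('f::field \<Rightarrow> 'k::field) \<Rightarrow> nat \<Rightarrow> (nat \<Rightarrow> 'f poly) \<Rightarrow> nat \<Rightarrow>
   (nat \<Rightarrow> 'f poly set \<Rightarrow> 'e::field) \<Rightarrow> (nat \<Rightarrow> 'n::finite \<Rightarrow> 'k alg_closure) \<Rightarrow>
   (nat \<Rightarrow> 'e ^ 'n ^ 'n) \<Rightarrow> (nat \<Rightarrow> 'k poly set)" where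
  "Theta_inv q \<iota> r \<qq> l \<sigma> \<beta> =
     inv_into (crt_carrier q (\<lambda>i. drinfeld \<iota> r (\<qq> i)) l) (Theta q \<iota> r \<qq> l \<sigma> \<beta>)"

definition sum_rank_weight :: "nat \<Rightarrow> (nat \<Rightarrow> 'e::field ^ 'n ^ 'n) \<Rightarrow> nat" where
  "sum_rank_weight l M = (\<Sum>i<l. rank (M i))"

section \<open>The key equation\<close>

definition key_equation ::
  "nat \<Rightarrow> 'k::field poly \<Rightarrow> 'k poly \<Rightarrow> nat \<Rightarrow> nat \<Rightarrow> nat \<Rightarrow> 'k poly \<Rightarrow> 'k poly \<Rightarrow> bool" where
  "key_equation q P Y m \<epsilon> K v N \<longleftrightarrow>
     skew_cong q P (v \<otimes>\<^bsub>skew_ring q\<^esub> Y) N \<and>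
     deg_tau v \<le> ereal (real (m * \<epsilon>)) \<and>
     deg_tau N \<le> ereal (real (m * \<epsilon>) + real K - 1)"

end

theory Submission
  imports Defs "HOL-Algebra.Sylow"
begin

text \<open>
  Skew polynomials act additively on the algebraic closure, and a nonzero \<open>F\<close> kills at most
  \<open>q\<^bsup>deg F\<^esup>\<close> elements, being a polynomial of that degree. The torsion modules of the distinct \<open>\<qq>\<^sub>i\<close>
  are independent and have \<open>q\<^bsup>m r\<^esup>\<close> elements each.

  For a solution \<open>(v, N)\<close> of the key equation, \<open>W = N - v u\<close> acts on the \<open>i\<close>-th torsion module as
  \<open>v E\<^sub>i\<close>, so it kills the kernel of \<open>E\<^sub>i\<close>. Together these kernels account for at least
  \<open>q\<^bsup>m (l r - \<epsilon>)\<^esup>\<close> roots, more than \<open>q\<^bsup>deg W\<^esup>\<close> unless \<open>W = 0\<close>. Conversely, a solution is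
  \<open>(v, v u)\<close> for any \<open>v\<close> that kills the images of all \<open>E\<^sub>i\<close>; as \<open>v\<close> commutes with the action of \<open>A\<close>,
  this amounts to at most \<open>\<epsilon>\<close> values in torsion modules being zero, and the pigeonhole principle
  provides such a \<open>v\<close> of degree at most \<open>m \<epsilon>\<close>.

  The same root count makes \<open>\<Theta>\<close> and the Chinese remainder map injective, and counting
  elements then makes them surjective.
\<close>

unbundle no fps_syntax

section \<open>Skew polynomials acting on the algebraic closure\<close>

text \<open>Sylow's theorem in the additive group yields, for each prime divisor \<open>s\<close> of
  the cardinality, a subgroup of order \<open>s\<close> and in it some \<open>x \<noteq> 0\<close>
  with \<open>s x = 0\<close>. Hence the characteristic divides \<open>s\<close>, so no other prime
  occurs in the factorization.\<close>

lemma CARD_finite_field: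
  obtains n where "CARD('a::finite_field) = CHAR('a) ^ n"
proof -
  have dvd: "s = CHAR('a)" if s: "Factorial_Ring.prime s" "s dvd CARD('a)" for s
  proof -
    define G where "G = \<lparr>carrier = (UNIV :: 'a set), monoid.mult = (+), one = (0 :: 'a)\<rparr>"
    interpret group G
    proof (rule groupI)
      fix x assume "x \<in> carrier G"
      show "\<exists>y\<in>carrier G. y \<otimes>\<^bsub>G\<^esub> x = \<one>\<^bsub>G\<^esub>"
        by (intro bexI[of _ "- x"]) (auto simp: G_def)
    qed (auto simp: G_def add_ac)
    obtain k where k: "CARD('a) = s ^ 1 * k"
      using s(2) by auto
    have "\<exists>H. subgroup H G \<and> card H = s ^ 1"
      by (rule sylow_thm[OF s(1) is_group, of 1 k]) (use k in \<open>auto simp: G_def order_def\<close>)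
    then obtain H where H: "subgroup H G" "card H = s"
      by auto
    have "finite H" "0 \<in> H"
      using H(1) subgroup.one_closed[OF H(1)] by (auto simp: G_def)
    then obtain x where x: "x \<in> H" "x \<noteq> 0"
      using prime_gt_1_nat[OF s(1)] H(2)
      by (metis is_singletonI' is_singleton_altdef less_irrefl empty_iff)
    interpret H: group "G\<lparr>carrier := H\<rparr>"
      using subgroup.subgroup_is_group[OF H(1) is_group] .
    have pow: "y [^]\<^bsub>G\<lparr>carrier := H\<rparr>\<^esub> (j::nat) = of_nat j * y" for y j
      by (induction j) (auto simp: nat_pow_def G_def algebra_simps)
    have "of_nat s * x = 0"
      using H.pow_order_eq_1[of x] x H(2) unfolding pow by (simp add: G_def order_def)
    hence "CHAR('a) dvd s"
      using x(2) by (simp add: of_nat_eq_0_iff_char_dvd)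
    thus ?thesis
      using s(1) prime_CHAR_semidom[where ?'a = 'a] finite_imp_CHAR_pos[where ?'a = 'a]
      by (metis finite_class.finite_UNIV primes_dvd_imp_eq)
  qed
  have "set_mset (prime_factorization CARD('a)) \<subseteq> {CHAR('a)}"
    using dvd by (auto simp: in_prime_factors_iff)
  hence "prime_factorization CARD('a) = replicate_mset (size (prime_factorization CARD('a))) CHAR('a)"
    by (rule set_mset_subset_singletonD)
  hence "prod_mset (prime_factorization CARD('a)) = CHAR('a) ^ size (prime_factorization CARD('a))"
    by (metis prod_mset_replicate_mset)
  hence "CARD('a) = CHAR('a) ^ size (prime_factorization CARD('a))"
    by (simp add: prod_mset_prime_factorization_nat)
  thus thesis
    by (rule that)
qed

section \<open>Skew products and their action as explicit sums\<close>

lemma skew_mult_eq_sum: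
  assumes "q > 0" "Polynomial.degree F \<le> a" "Polynomial.degree G \<le> b"
  shows "skew_mult q F G =
    (\<Sum>i\<le>a. \<Sum>j\<le>b. Polynomial.monom (Polynomial.coeff F i * Polynomial.coeff G j ^ (q ^ i)) (i + j))"
proof -
  have "skew_mult q F G = (\<Sum>i\<le>Polynomial.degree F. \<Sum>j\<le>b.
      Polynomial.monom (Polynomial.coeff F i * Polynomial.coeff G j ^ (q ^ i)) (i + j))"
    \<comment> \<open>Since \<open>q > 0\<close>, the exponents \<open>q ^ i\<close> are positive,
      so the vanishing coefficients of \<open>G\<close> above its degree contribute zero.\<close>
    unfolding skew_mult_def using assms
    by (intro sum.cong refl sum.mono_neutral_left) (auto simp: coeff_eq_0)
  also have "\<dots> = (\<Sum>i\<le>a. \<Sum>j\<le>b.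
      Polynomial.monom (Polynomial.coeff F i * Polynomial.coeff G j ^ (q ^ i)) (i + j))"
    using assms by (intro sum.mono_neutral_left) (auto simp: coeff_eq_0)
  finally show ?thesis .
qed

lemma tau_act_eq_sum:
  assumes "Polynomial.degree F \<le> n"
  shows "tau_act q F x = (\<Sum>i\<le>n. to_ac (Polynomial.coeff F i) * x ^ (q ^ i))"
  unfolding tau_act_def using assms by (intro sum.mono_neutral_left) (auto simp: coeff_eq_0)

lemma tau_act_0 [simp]: "tau_act q 0 x = 0"
  by (simp add: tau_act_def)

lemma tau_act_monom: "tau_act q (Polynomial.monom c n) x = to_ac c * x ^ (q ^ n)"
proof -
  have "tau_act q (Polynomial.monom c n) x =
      (\<Sum>i\<le>n. to_ac (Polynomial.coeff (Polynomial.monom c n) i) * x ^ (q ^ i))"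
    by (rule tau_act_eq_sum) (simp add: degree_monom_le)
  also have "\<dots> = (\<Sum>i\<in>{n}. to_ac (Polynomial.coeff (Polynomial.monom c n) i) * x ^ (q ^ i))"
    by (intro sum.mono_neutral_right) auto
  finally show ?thesis by simp
qed

lemma tau_act_add: "tau_act q (F + G) x = tau_act q F x + tau_act q G x"
proof -
  define n where "n = max (Polynomial.degree F) (Polynomial.degree G)"
  have "Polynomial.degree F \<le> n" "Polynomial.degree G \<le> n" "Polynomial.degree (F + G) \<le> n"
    by (auto simp: n_def degree_add_le)
  thus ?thesis
    by (simp add: tau_act_eq_sum algebra_simps sum.distrib)
qed

lemma tau_act_diff: "tau_act q (F - G) x = tau_act q F x - tau_act q G x"
  using tau_act_add[of q "F - G" G x] by simp

lemma tau_act_sum: "tau_act q (\<Sum>i\<in>A. F i) x = (\<Sum>i\<in>A. tau_act q (F i) x)"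
  by (induction A rule: infinite_finite_induct) (auto simp: tau_act_add)

lemma deg_tau_le_iff: "deg_tau F \<le> ereal c \<longleftrightarrow> F = 0 \<or> real (Polynomial.degree F) \<le> c"
  by (simp add: deg_tau_def)

lemma deg_tau_less_iff: "deg_tau F < ereal c \<longleftrightarrow> F = 0 \<or> real (Polynomial.degree F) < c"
  by (simp add: deg_tau_def)

lemma deg_tau_less_deg_tau_iff:
  "G \<noteq> 0 \<Longrightarrow> deg_tau F < deg_tau G \<longleftrightarrow> F = 0 \<or> Polynomial.degree F < Polynomial.degree G"
  by (simp add: deg_tau_def)

text \<open>Bounding coefficient indices instead of the degree keeps 0 in the set even for
  \<open>n = 0\<close> and identifies the set with \<open>n\<close>-tuples; the later surjectivity
  and pigeonhole counts rest on this.\<close>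

lemma bij_betw_coeff_bounded:
  "bij_betw (\<lambda>F. \<lambda>i\<in>{..<n}. Polynomial.coeff F i) {F :: 'a::zero poly. \<forall>i\<ge>n. Polynomial.coeff F i = 0}
     ({..<n} \<rightarrow>\<^sub>E UNIV)"
proof (rule bij_betwI[where g = "\<lambda>f. Abs_poly (\<lambda>i. if i < n then f i else 0)"])
  have coeff: "Polynomial.coeff (Abs_poly (\<lambda>i. if i < n then f i else 0)) = (\<lambda>i. if i < n then f i else (0::'a))" for f
    by (rule Abs_poly_inverse) (auto simp: MOST_nat intro!: exI[of _ n])
  show "(\<lambda>f. Abs_poly (\<lambda>i. if i < n then f i else 0)) \<in>
      ({..<n} \<rightarrow>\<^sub>E UNIV) \<rightarrow> {F :: 'a poly. \<forall>i\<ge>n. Polynomial.coeff F i = 0}"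
    by (auto simp: coeff)
  show "Abs_poly (\<lambda>i. if i < n then (\<lambda>i\<in>{..<n}. Polynomial.coeff F i) i else 0) = F"
    if "F \<in> {F. \<forall>i\<ge>n. Polynomial.coeff F i = 0}" for F :: "'a poly"
    by (rule poly_eqI) (use that in \<open>auto simp: coeff\<close>)
  show "(\<lambda>i\<in>{..<n}. Polynomial.coeff (Abs_poly (\<lambda>i. if i < n then f i else 0)) i) = f"
    if "f \<in> {..<n} \<rightarrow>\<^sub>E (UNIV :: 'a set)" for f
    using that by (auto simp: coeff fun_eq_iff PiE_def extensional_def)
qed auto

lemma card_coeff_bounded:
  "card {F :: 'a::{zero,finite} poly. \<forall>i\<ge>n. Polynomial.coeff F i = 0} = CARD('a) ^ n"
  using bij_betw_same_card[OF bij_betw_coeff_bounded[of n, where ?'a = 'a]] by (simp add: card_PiE)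

lemma coeff_bounded_iff:
  "(\<forall>i\<ge>n. Polynomial.coeff F i = 0) \<longleftrightarrow> F = 0 \<or> Polynomial.degree F < n"
  by (metis coeff_0 coeff_eq_0 leading_coeff_0_iff linorder_not_le order_less_le_trans)

section \<open>Frobenius powers and composition over the field with \<open>q ^ r\<close>
  elements\<close>

locale drinfeld_setting =
  fixes \<iota> :: "'f::finite_field \<Rightarrow> 'k::finite_field" and q r :: nat
  assumes q_def: "q = CARD('f)" and r_pos: "r \<ge> 1" and card_k: "CARD('k) = q ^ r"
    and \<iota>_hom: "\<iota> \<in> ring_hom type_ring type_ring"
begin

abbreviation mult :: "'k poly \<Rightarrow> 'k poly \<Rightarrow> 'k poly" (infixl "\<star>" 70) where "F \<star> G \<equiv> skew_mult q F G"
abbreviation act :: "'k poly \<Rightarrow> 'k alg_closure \<Rightarrow> 'k alg_closure" where "act \<equiv> tau_act q"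
abbreviation D where "D \<equiv> drinfeld \<iota> r"

lemma q_gt_1: "q > 1"
proof -
  have "card {0, 1 :: 'f} \<le> CARD('f)"
    by (rule card_mono) auto
  thus ?thesis by (simp add: q_def)
qed

lemma q_pos: "q > 0"
  using q_gt_1 by simp

text \<open>\<open>CHAR('k)\<close> divides \<open>CARD('k)\<close>, which is a power of
  \<open>CHAR('f)\<close>, so the two primes coincide. This makes exponents \<open>q ^ i\<close>
  additive in characteristic \<open>CHAR('k)\<close>.\<close>

lemma q_power_CHAR: obtains n where "q = CHAR('k) ^ n"
proof -
  obtain a where a: "CARD('f) = CHAR('f) ^ a"
    by (rule CARD_finite_field)
  obtain b where b: "CARD('k) = CHAR('k) ^ b"
    by (rule CARD_finite_field)
  have "b > 0"
    using b card_k q_gt_1 r_pos by (metis gr0I one_less_power power_0 less_irrefl order_less_le_trans zero_less_one)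
  hence "CHAR('k) dvd (CHAR('f) ^ a) ^ r"
    using a b card_k q_def by (metis dvd_power)
  hence "CHAR('k) dvd CHAR('f)"
    using prime_dvd_power[of "CHAR('k)"]
    by (metis prime_CHAR_semidom finite_imp_CHAR_pos finite_class.finite_UNIV)
  hence "CHAR('k) = CHAR('f)"
    by (intro primes_dvd_imp_eq) auto
  thus thesis
    using that a q_def by auto
qed

text \<open>The type is left open because the identity is needed both for coefficients in
  \<open>'k\<close> and for points of the algebraic closure.\<close>

lemma frobenius_add:
  fixes x y :: "'a::comm_semiring_1"
  assumes "CHAR('a) = CHAR('k)"
  shows "(x + y) ^ (q ^ i) = x ^ (q ^ i) + y ^ (q ^ i)"
proof -
  obtain n where n: "q = CHAR('k) ^ n"
    by (rule q_power_CHAR)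
  show ?thesis
    by (rule freshmans_dream'[where n = "n * i"]) (use assms n in \<open>simp_all add: power_mult\<close>)
qed

lemma frobenius_sum:
  fixes f :: "'b \<Rightarrow> 'a::comm_semiring_1"
  assumes "CHAR('a) = CHAR('k)"
  shows "sum f A ^ (q ^ i) = (\<Sum>a\<in>A. f a ^ (q ^ i))"
proof -
  obtain n where n: "q = CHAR('k) ^ n"
    by (rule q_power_CHAR)
  show ?thesis
    by (rule freshmans_dream_sum'[where n = "n * i"]) (use assms n in \<open>simp_all add: power_mult\<close>)
qed

lemma \<iota>_simps [simp]: "\<iota> (a + b) = \<iota> a + \<iota> b" "\<iota> (a * b) = \<iota> a * \<iota> b" "\<iota> 1 = 1" "\<iota> 0 = 0"
proof -
  show add: "\<iota> (a + b) = \<iota> a + \<iota> b" for a b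
    using ring_hom_add[OF \<iota>_hom, of a b] by (simp add: ring_of_type_algebra_def)
  show "\<iota> (a * b) = \<iota> a * \<iota> b"
    using ring_hom_mult[OF \<iota>_hom, of a b] by (simp add: ring_of_type_algebra_def)
  show "\<iota> 1 = 1"
    using ring_hom_one[OF \<iota>_hom] by (simp add: ring_of_type_algebra_def)
  show "\<iota> 0 = 0"
    using add[of 0 0] by (metis add.right_neutral add_left_imp_eq)
qed

lemma \<iota>_power: "\<iota> (a ^ n) = \<iota> a ^ n"
  by (induction n) auto

lemma \<iota>_frobenius: "\<iota> c ^ (q ^ i) = \<iota> c"
  using finite_field_power_card_power_eq_same[of "q ^ i" i c] by (simp add: q_def flip: \<iota>_power)

lemma frobenius_k: "(c :: 'k) ^ (q ^ r) = c"
  using finite_field_power_card_eq_same[of c] by (simp add: card_k)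

lemma act_0_right [simp]: "act F 0 = 0"
  using q_pos by (simp add: tau_act_def power_0_left)

lemma act_add_right: "act F (x + y) = act F x + act F y"
  by (simp add: tau_act_def frobenius_add algebra_simps sum.distrib)

lemma act_diff_right: "act F (x - y) = act F x - act F y"
  using act_add_right[of F "x - y" y] by simp

lemma act_sum_right: "act F (\<Sum>i\<in>A. f i) = (\<Sum>i\<in>A. act F (f i))"
  by (induction A rule: infinite_finite_induct) (auto simp: act_add_right)

text \<open>Raising the inner sum to the power \<open>q ^ i\<close> twists each coefficient of
  \<open>G\<close> exactly as the skew product does, so skew multiplication is composition of
  additive maps.\<close>

lemma act_mult: "act (F \<star> G) x = act F (act G x)"
proof -
  have "act (F \<star> G) x = (\<Sum>i\<le>Polynomial.degree F. \<Sum>j\<le>Polynomial.degree G.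
      to_ac (Polynomial.coeff F i) * (to_ac (Polynomial.coeff G j) * x ^ (q ^ j)) ^ (q ^ i))"
    by (simp add: skew_mult_def tau_act_sum tau_act_monom power_add power_mult power_mult_distrib
        mult.assoc)
       (simp add: mult.commute flip: power_mult)
  also have "\<dots> = act F (act G x)"
    unfolding tau_act_def by (simp add: frobenius_sum sum_distrib_left)
  finally show ?thesis .
qed

section \<open>Distributivity, degrees and division of skew polynomials\<close>

lemma mult_add_left: "(F + F') \<star> G = F \<star> G + F' \<star> G"
proof -
  define a where "a = max (Polynomial.degree F) (Polynomial.degree F')"
  have "Polynomial.degree F \<le> a" "Polynomial.degree F' \<le> a" "Polynomial.degree (F + F') \<le> a"
    by (auto simp: a_def degree_add_le)
  thus ?thesis
    using q_pos by (simp add: skew_mult_eq_sum[where a = a and b = "Polynomial.degree G"]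
        algebra_simps sum.distrib flip: add_monom)
qed

lemma mult_add_right: "F \<star> (G + G') = F \<star> G + F \<star> G'"
proof -
  define b where "b = max (Polynomial.degree G) (Polynomial.degree G')"
  have "Polynomial.degree G \<le> b" "Polynomial.degree G' \<le> b" "Polynomial.degree (G + G') \<le> b"
    by (auto simp: b_def degree_add_le)
  thus ?thesis
    using q_pos by (simp add: skew_mult_eq_sum[where a = "Polynomial.degree F" and b = b]
        frobenius_add algebra_simps sum.distrib flip: add_monom)
qed

lemma mult_diff_left: "(F - F') \<star> G = F \<star> G - F' \<star> G"
  using mult_add_left[of "F - F'" F' G] by simp

lemma mult_diff_right: "F \<star> (G - G') = F \<star> G - F \<star> G'"
  using mult_add_right[of F "G - G'" G'] by simp

lemma mult_0 [simp]: "0 \<star> G = 0" "F \<star> 0 = 0"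
  using mult_diff_left[of 0 0 G] mult_diff_right[of F 0 0] by simp_all

lemma degree_mult_le: "Polynomial.degree (F \<star> G) \<le> Polynomial.degree F + Polynomial.degree G"
  unfolding skew_mult_def
  by (intro degree_sum_le order.trans[OF degree_monom_le]) auto

lemma coeff_mult_top:
  "Polynomial.coeff (F \<star> G) (Polynomial.degree F + Polynomial.degree G) =
     Polynomial.lead_coeff F * Polynomial.lead_coeff G ^ (q ^ Polynomial.degree F)"
proof -
  let ?a = "Polynomial.degree F" and ?b = "Polynomial.degree G"
  let ?c = "\<lambda>i j. Polynomial.coeff F i * Polynomial.coeff G j ^ (q ^ i)"
  have "Polynomial.coeff (F \<star> G) (?a + ?b) =
      (\<Sum>i\<le>?a. \<Sum>j\<le>?b. if i = ?a \<and> j = ?b then ?c i j else 0)"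
    unfolding skew_mult_def Polynomial.coeff_sum coeff_monom by (intro sum.cong refl) auto
  also have "\<dots> = (\<Sum>i\<le>?a. if i = ?a then \<Sum>j\<le>?b. if j = ?b then ?c i j else 0 else 0)"
    by (intro sum.cong refl) auto
  also have "\<dots> = ?c ?a ?b"
    by simp
  finally show ?thesis .
qed

text \<open>A Frobenius power of a nonzero field element is nonzero, so the top coefficient of the
  product survives and there are no zero divisors.\<close>

lemma
  assumes "F \<noteq> 0" "G \<noteq> 0"
  shows mult_nonzero: "F \<star> G \<noteq> 0"
    and degree_mult: "Polynomial.degree (F \<star> G) = Polynomial.degree F + Polynomial.degree G"
    and lead_coeff_mult: "Polynomial.lead_coeff (F \<star> G) =
      Polynomial.lead_coeff F * Polynomial.lead_coeff G ^ (q ^ Polynomial.degree F)"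
proof -
  have nz: "Polynomial.coeff (F \<star> G) (Polynomial.degree F + Polynomial.degree G) \<noteq> 0"
    using assms by (simp add: coeff_mult_top)
  thus "F \<star> G \<noteq> 0" by auto
  show deg: "Polynomial.degree (F \<star> G) = Polynomial.degree F + Polynomial.degree G"
    using degree_mult_le[of F G] le_degree[OF nz] by simp
  show "Polynomial.lead_coeff (F \<star> G) =
      Polynomial.lead_coeff F * Polynomial.lead_coeff G ^ (q ^ Polynomial.degree F)"
    by (simp add: deg coeff_mult_top)
qed

text \<open>With \<open>G\<close> monic, its twisted leading coefficient is still 1, so a monomial
  on the left cancels the top term of \<open>F\<close>. The quotient stands on the left of
  \<open>G\<close>, matching the left ideals \<open>R P\<close>.\<close>

lemma right_division:
  assumes G: "Polynomial.lead_coeff G = 1"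
  obtains H S where "F = H \<star> G + S" "S = 0 \<or> Polynomial.degree S < Polynomial.degree G"
proof -
  have "\<exists>H S. F = H \<star> G + S \<and> (S = 0 \<or> Polynomial.degree S < Polynomial.degree G)"
  proof (induction "Polynomial.degree F" arbitrary: F rule: less_induct)
    case less
    let ?n = "Polynomial.degree F" and ?d = "Polynomial.degree G"
    show ?case
    proof (cases "F = 0 \<or> ?n < ?d")
      case True
      thus ?thesis by (intro exI[of _ 0] exI[of _ F]) simp
    next
      case False
      define M where "M = Polynomial.monom (Polynomial.lead_coeff F) (?n - ?d)"
      have [simp]: "M \<noteq> 0" "G \<noteq> 0" and degM: "Polynomial.degree M = ?n - ?d"
        using False G by (auto simp: M_def monom_eq_0_iff degree_monom_eq)
      have deg: "Polynomial.degree (M \<star> G) = ?n"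
        using False degM by (simp add: degree_mult)
      have lc: "Polynomial.lead_coeff (M \<star> G) = Polynomial.lead_coeff F"
        by (simp add: lead_coeff_mult G degM) (simp add: M_def)
      define F' where "F' = F - M \<star> G"
      have "Polynomial.degree F' \<le> ?n"
        using deg by (simp add: F'_def degree_diff_le)
      moreover have "Polynomial.coeff F' ?n = 0"
        using deg lc by (simp add: F'_def)
      \<comment> \<open>For constant \<open>F\<close> the difference is zero and its degree does not
        drop, so \<open>F' = 0\<close> cannot go through the induction hypothesis.\<close>
      ultimately have F': "F' = 0 \<or> Polynomial.degree F' < ?n"
        by (metis le_neq_implies_less leading_coeff_0_iff)
      hence "\<exists>H S. F' = H \<star> G + S \<and> (S = 0 \<or> Polynomial.degree S < ?d)"
      proof
        assume "F' = 0"
        thus ?thesis by (intro exI[of _ 0]) simp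
      qed (rule less)
      then obtain H S where "F' = H \<star> G + S" "S = 0 \<or> Polynomial.degree S < ?d"
        by blast
      hence "F = (M + H) \<star> G + S"
        by (simp add: mult_add_left F'_def algebra_simps)
      thus ?thesis
        using \<open>S = 0 \<or> _\<close> by blast
    qed
  qed
  thus thesis
    using that by blast
qed

text \<open>\<open>F\<close> acts by evaluation of the linearized polynomial \<open>p\<close>. Since
  \<open>q > 1\<close>, the exponents \<open>q ^ i\<close> are distinct, so the leading coefficient
  of \<open>F\<close> survives in \<open>p\<close>, which is therefore nonzero.\<close>

lemma
  assumes "F \<noteq> 0"
  shows finite_kernel: "finite {x. act F x = 0}"
    and card_kernel_le: "card {x. act F x = 0} \<le> q ^ Polynomial.degree F"
proof -
  define p where "p = (\<Sum>i\<le>Polynomial.degree F.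
    Polynomial.monom (to_ac (Polynomial.coeff F i)) (q ^ i))"
  have poly: "poly p x = act F x" for x
    by (simp add: p_def poly_sum poly_monom tau_act_def)
  have inj: "q ^ i = q ^ j \<longleftrightarrow> i = j" for i j
    using q_gt_1 by simp
  have "Polynomial.coeff p (q ^ Polynomial.degree F) = to_ac (Polynomial.lead_coeff F)"
    by (simp add: p_def Polynomial.coeff_sum coeff_monom inj)
  hence p: "p \<noteq> 0"
    using assms by auto
  have "Polynomial.degree p \<le> q ^ Polynomial.degree F"
    unfolding p_def
    by (intro degree_sum_le order.trans[OF degree_monom_le] power_increasing) (use q_pos in auto)
  thus "card {x. act F x = 0} \<le> q ^ Polynomial.degree F"
    using card_poly_roots_bound[OF p] by (simp add: poly)
  show "finite {x. act F x = 0}"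
    using poly_roots_finite[OF p] by (simp add: poly)
qed

text \<open>Later vanishing proofs on torsion end in this root count. Zero is listed separately
  because its \<open>degree\<close> is 0.\<close>

lemma kernel_card_imp_eq_0:
  assumes "S \<subseteq> {x. act F x = 0}" "q ^ n \<le> card S" "F = 0 \<or> Polynomial.degree F < n"
  shows "F = 0"
proof (rule ccontr)
  assume F: "F \<noteq> 0"
  have "q ^ n \<le> q ^ Polynomial.degree F"
    using card_mono[OF finite_kernel[OF F] assms(1)] card_kernel_le[OF F] assms(2) by linarith
  hence "n \<le> Polynomial.degree F"
    using q_gt_1 by simp
  thus False
    using F assms(3) by simp
qed

section \<open>The action of the Drinfeld module\<close>

lemma act_drinfeld_eq_sum:
  assumes "Polynomial.degree a \<le> n"
  shows "act (D a) x = (\<Sum>j\<le>n. to_ac (\<iota> (Polynomial.coeff a j)) * x ^ (q ^ (r * j)))"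
  unfolding drinfeld_def tau_act_sum tau_act_monom
  using assms by (intro sum.mono_neutral_left) (auto simp: coeff_eq_0)

lemma act_drinfeld_0 [simp]: "act (D 0) x = 0"
  by (simp add: drinfeld_def tau_act_monom)

lemma act_drinfeld_add: "act (D (a + b)) x = act (D a) x + act (D b) x"
proof -
  define n where "n = max (Polynomial.degree a) (Polynomial.degree b)"
  have "Polynomial.degree a \<le> n" "Polynomial.degree b \<le> n" "Polynomial.degree (a + b) \<le> n"
    by (auto simp: n_def degree_add_le)
  thus ?thesis
    by (simp add: act_drinfeld_eq_sum algebra_simps sum.distrib)
qed

lemma act_drinfeld_diff: "act (D (a - b)) x = act (D a) x - act (D b) x"
  using act_drinfeld_add[of "a - b" b x] by simp

lemma act_drinfeld_smult: "act (D (Polynomial.smult c a)) x = to_ac (\<iota> c) * act (D a) x"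
  by (simp add: act_drinfeld_eq_sum[OF degree_smult_le] act_drinfeld_eq_sum[OF order.refl]
      sum_distrib_left mult.assoc)

text \<open>\<open>T\<close> acts as the \<open>q ^ r\<close>-power map, so this recursion reflects
  writing a polynomial as \<open>c + T a\<close>; it drives the inductions over
  \<open>A\<close>.\<close>

lemma act_drinfeld_pCons: "act (D (pCons c a)) x = to_ac (\<iota> c) * x + act (D a) (x ^ (q ^ r))"
proof -
  have "act (D (pCons c a)) x = (\<Sum>j\<le>Suc (Polynomial.degree a).
      to_ac (\<iota> (Polynomial.coeff (pCons c a) j)) * x ^ (q ^ (r * j)))"
    by (rule act_drinfeld_eq_sum) (simp add: degree_pCons_le)
  also have "\<dots> = to_ac (\<iota> c) * x + act (D a) (x ^ (q ^ r))"
    by (simp add: sum.atMost_Suc_shift act_drinfeld_eq_sum[OF order.refl] power_add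
        power_mult del: sum.atMost_Suc)
  finally show ?thesis .
qed

lemma act_frobenius: "act F (x ^ (q ^ r)) = act F x ^ (q ^ r)"
  by (simp add: tau_act_def frobenius_sum power_mult_distrib frobenius_k flip: to_ac_power power_mult)
     (simp add: mult.commute)

lemma act_scale: "act F (to_ac (\<iota> c) * x) = to_ac (\<iota> c) * act F x"
  by (simp add: tau_act_def sum_distrib_left power_mult_distrib \<iota>_frobenius mult_ac
      flip: to_ac_power)

text \<open>Coefficients of \<open>F\<close> are fixed by the \<open>q ^ r\<close>-power map and
  scalars from \<open>\<iota>\<close> by every \<open>q ^ i\<close>-power map, so \<open>F\<close>
  commutes with both parts of the recursion. This is the centrality of \<open>D a\<close>, seen on
  points.\<close>

lemma act_drinfeld_commute: "act F (act (D a) x) = act (D a) (act F x)"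
proof (induction a arbitrary: x)
  case (pCons c a)
  show ?case
    by (simp add: act_drinfeld_pCons act_add_right act_scale pCons.IH act_frobenius)
qed simp

lemma act_drinfeld_mult: "act (D (a * b)) x = act (D a) (act (D b) x)"
proof (induction a arbitrary: x)
  case (pCons c a)
  show ?case
    by (simp add: act_drinfeld_pCons act_drinfeld_add act_drinfeld_smult pCons.IH act_frobenius)
qed simp

lemma act_drinfeld_1 [simp]: "act (D 1) x = x"
  by (simp add: one_pCons act_drinfeld_pCons)

text \<open>Because \<open>r > 0\<close>, the exponents \<open>r * j\<close> are distinct and no two
  terms merge.\<close>

lemma
  assumes "Polynomial.lead_coeff a = 1"
  shows degree_drinfeld: "Polynomial.degree (D a) = r * Polynomial.degree a"
    and lead_coeff_drinfeld: "Polynomial.lead_coeff (D a) = 1"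
proof -
  have c: "Polynomial.coeff (D a) (r * Polynomial.degree a) = 1"
    using r_pos assms by (simp add: drinfeld_def Polynomial.coeff_sum coeff_monom)
  have "Polynomial.degree (D a) \<le> r * Polynomial.degree a"
    unfolding drinfeld_def by (intro degree_sum_le order.trans[OF degree_monom_le]) auto
  thus "Polynomial.degree (D a) = r * Polynomial.degree a"
    using c le_degree[of "D a" "r * Polynomial.degree a"] by simp
  thus "Polynomial.lead_coeff (D a) = 1"
    using c by simp
qed

section \<open>The ring record in terms of polynomials, and closure properties of torsion\<close>

lemma skew_ring_simps:
  "carrier (skew_ring q) = (UNIV :: 'k poly set)"
  "F \<otimes>\<^bsub>skew_ring q\<^esub> G = F \<star> G" "F \<oplus>\<^bsub>skew_ring q\<^esub> G = F + G"
  "\<one>\<^bsub>skew_ring q\<^esub> = (1 :: 'k poly)" "\<zero>\<^bsub>skew_ring q\<^esub> = (0 :: 'k poly)"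
  by (simp_all add: skew_ring_def)

lemma skew_ring_minus: "F \<ominus>\<^bsub>skew_ring q\<^esub> G = F - (G :: 'k poly)"
proof -
  interpret abelian_group "skew_ring q :: 'k poly ring"
    by (rule abelian_groupI) (auto simp: skew_ring_simps add_ac intro: exI[of _ "- _"])
  have "\<ominus>\<^bsub>skew_ring q\<^esub> G = - G"
    by (rule minus_equality) (auto simp: skew_ring_simps)
  thus ?thesis
    by (simp add: a_minus_def skew_ring_simps)
qed

lemma skew_cong_iff: "skew_cong q P F G \<longleftrightarrow> (\<exists>H. F - G = H \<star> P)"
  by (auto simp: skew_cong_def skew_ring_minus cgenideal_def skew_ring_simps)

lemma torsion_iff: "x \<in> torsion q \<iota> r a \<longleftrightarrow> act (D a) x = 0"
  by (simp add: torsion_def)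

lemma act_torsion: "x \<in> torsion q \<iota> r a \<Longrightarrow> act F x \<in> torsion q \<iota> r a"
  by (simp add: torsion_iff flip: act_drinfeld_commute)

lemma torsion_0 [simp]: "0 \<in> torsion q \<iota> r a"
  by (simp add: torsion_iff)

lemma torsion_add: "x \<in> torsion q \<iota> r a \<Longrightarrow> y \<in> torsion q \<iota> r a \<Longrightarrow> x + y \<in> torsion q \<iota> r a"
  by (simp add: torsion_iff act_add_right)

lemma torsion_diff: "x \<in> torsion q \<iota> r a \<Longrightarrow> y \<in> torsion q \<iota> r a \<Longrightarrow> x - y \<in> torsion q \<iota> r a"
  by (simp add: torsion_iff act_diff_right)

lemma torsion_sum: "(\<And>i. i \<in> A \<Longrightarrow> f i \<in> torsion q \<iota> r a) \<Longrightarrow> sum f A \<in> torsion q \<iota> r a"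
  by (simp add: torsion_iff act_sum_right)

end

section \<open>The torsion module of a prime\<close>

lemma residue_class_eq: "residue_class p a = {b. p dvd b - a}"
proof -
  have "b \<in> residue_class p a \<longleftrightarrow> p dvd b - a" for b
  proof -
    have "b \<in> residue_class p a \<longleftrightarrow> (\<exists>h. b = h * p + a)"
      by (auto simp: residue_class_def a_r_coset_def' cgenideal_def ring_of_type_algebra_def)
    also have "\<dots> \<longleftrightarrow> (\<exists>h. b - a = p * h)"
      by (simp add: algebra_simps)
    finally show ?thesis by (simp add: dvd_def)
  qed
  thus ?thesis by blast
qed

lemma residue_class_eq_iff: "residue_class p a = residue_class p b \<longleftrightarrow> p dvd a - b"
proof
  assume "residue_class p a = residue_class p b"
  hence "a \<in> residue_class p b"
    by (auto simp: residue_class_eq)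
  thus "p dvd a - b"
    by (simp add: residue_class_eq)
next
  assume ab: "p dvd a - b"
  have "p dvd c - a \<longleftrightarrow> p dvd c - b" for c
    using dvd_add_left_iff[OF ab, of "c - a"] by simp
  thus "residue_class p a = residue_class p b"
    by (simp add: residue_class_eq)
qed

section \<open>Torsion of one prime as a vector space over its residue field\<close>

locale torsion_module = drinfeld_setting \<iota> q r
  for \<iota> :: "'f::finite_field \<Rightarrow> 'k::finite_field" and q r :: nat +
  fixes m :: nat and p :: "'f poly" and \<sigma> :: "'f poly set \<Rightarrow> 'e::finite_field"
    and \<beta> :: "'n::finite \<Rightarrow> 'k alg_closure"
  assumes r_def: "r = CARD('n)" and card_e: "CARD('e) = q ^ m"
    and monic_p: "Polynomial.lead_coeff p = 1" and degree_p: "Polynomial.degree p = m"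
    and \<sigma>_iso: "residue_iso p \<sigma>" and \<beta>_basis: "torsion_basis q \<iota> r p \<sigma> \<beta>"
begin

abbreviation T where "T \<equiv> torsion q \<iota> r p"
abbreviation red where "red a \<equiv> \<sigma> (residue_class p a)"
abbreviation scale where "scale \<equiv> torsion_smult q \<iota> r p \<sigma>"
abbreviation comb where "comb \<equiv> torsion_comb q \<iota> r p \<sigma> \<beta>"
abbreviation coset where "coset u \<equiv> PIdl\<^bsub>skew_ring q\<^esub> (D p) +>\<^bsub>skew_ring q\<^esub> u"
abbreviation mat where "mat \<equiv> Theta_comp q \<iota> r p \<sigma> \<beta>"

lemma red_hom: "red \<in> ring_hom type_ring type_ring"
proof -
  interpret ideal "PIdl\<^bsub>type_ring\<^esub> p" "type_ring :: 'f poly ring"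
    by (intro cring.cgenideal_ideal cring_from_type_algebra) (simp add: ring_of_type_algebra_def)
  have "\<sigma> \<in> ring_hom (type_ring Quot (PIdl\<^bsub>type_ring\<^esub> p)) type_ring"
    using \<sigma>_iso by (simp add: residue_iso_def ring_iso_def)
  from ring_hom_trans[OF rcos_ring_hom this] show ?thesis
    by (simp add: comp_def residue_class_def)
qed

lemma red_add: "red (a + b) = red a + red b"
  and red_mult: "red (a * b) = red a * red b"
  and red_1: "red 1 = 1"
  using ring_hom_add[OF red_hom, of a b] ring_hom_mult[OF red_hom, of a b] ring_hom_one[OF red_hom]
  by (simp_all add: ring_of_type_algebra_def)

lemma carrier_residue_ring: "carrier (type_ring Quot (PIdl\<^bsub>type_ring\<^esub> p)) = range (residue_class p)"
  unfolding FactRing_def A_RCOSETS_def' residue_class_def[abs_def]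
  by (auto simp: ring_of_type_algebra_def)

lemma surj_red: "surj red"
proof -
  have "\<sigma> ` range (residue_class p) = UNIV"
    using \<sigma>_iso unfolding residue_iso_def ring_iso_def carrier_residue_ring[symmetric]
    by (auto simp: bij_betw_def ring_of_type_algebra_def)
  thus ?thesis by (simp add: image_image)
qed

lemma red_eq_iff: "red a = red b \<longleftrightarrow> p dvd a - b"
proof -
  have "inj_on \<sigma> (range (residue_class p))"
    using \<sigma>_iso unfolding residue_iso_def ring_iso_def carrier_residue_ring[symmetric]
    by (auto simp: bij_betw_def)
  thus ?thesis
    by (simp add: inj_on_eq_iff flip: residue_class_eq_iff)
qed

text \<open>Two preimages of \<open>c\<close> differ by a multiple of \<open>p\<close>, and
  \<open>D p\<close> kills the torsion, so the representative chosen in \<open>torsion_smult\<close>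
  may be replaced by any other.\<close>

lemma scale_eq:
  assumes "x \<in> T" "red a = c"
  shows "scale c x = act (D a) x"
proof -
  define b where "b = (SOME b. red b = c)"
  have "red b = c"
    unfolding b_def using assms(2) by (rule someI)
  hence "p dvd b - a"
    using assms(2) red_eq_iff by metis
  then obtain h where h: "b - a = h * p"
    by (metis dvdE mult.commute)
  have "act (D b) x - act (D a) x = act (D h) (act (D p) x)"
    by (simp add: h flip: act_drinfeld_diff act_drinfeld_mult)
  also have "\<dots> = 0"
    using assms(1) by (simp add: torsion_iff)
  finally show ?thesis
    by (simp add: torsion_smult_def b_def)
qed

lemma red_cases: obtains a where "red a = c"
  using surj_red by (metis surjD)

lemma scale_in_T: "x \<in> T \<Longrightarrow> scale c x \<in> T"
  by (metis act_torsion red_cases scale_eq)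

lemma scale_add: "x \<in> T \<Longrightarrow> scale (c + d) x = scale c x + scale d x"
  by (metis act_drinfeld_add red_add red_cases scale_eq)

lemma scale_mult: "x \<in> T \<Longrightarrow> scale (c * d) x = scale c (scale d x)"
proof -
  assume x: "x \<in> T"
  obtain a where a: "red a = c" by (rule red_cases)
  obtain b where b: "red b = d" by (rule red_cases)
  show ?thesis
    using x a b scale_eq[OF x, of "a * b" "c * d"] scale_eq[OF x b] scale_eq[OF act_torsion[OF x] a]
    by (simp add: red_mult act_drinfeld_mult)
qed

lemma scale_1: "x \<in> T \<Longrightarrow> scale 1 x = x"
  using scale_eq[of x 1 1] red_1 by simp

lemma scale_0: "x \<in> T \<Longrightarrow> scale 0 x = 0"
  using scale_add[of x 0 0] by (metis add.right_neutral add_left_imp_eq)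

lemma scale_add_right: "x \<in> T \<Longrightarrow> y \<in> T \<Longrightarrow> scale c (x + y) = scale c x + scale c y"
  by (metis act_add_right red_cases scale_eq torsion_add)

lemma scale_0_right: "scale c 0 = 0"
  by (metis act_0_right red_cases scale_eq torsion_0)

lemma scale_sum_right:
  "finite A \<Longrightarrow> (\<And>i. i \<in> A \<Longrightarrow> f i \<in> T) \<Longrightarrow> scale c (sum f A) = (\<Sum>i\<in>A. scale c (f i))"
  by (induction A rule: finite_induct) (auto simp: scale_0_right scale_add_right torsion_sum)

lemma act_scale_commute: "x \<in> T \<Longrightarrow> act F (scale c x) = scale c (act F x)"
  by (metis act_drinfeld_commute act_torsion red_cases scale_eq)

lemma scale_eq_0_iff:
  assumes "x \<in> T"
  shows "scale c x = 0 \<longleftrightarrow> c = 0 \<or> x = 0"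
proof (intro iffI)
  assume *: "scale c x = 0"
  show "c = 0 \<or> x = 0"
  proof (cases "c = 0")
    case False
    thus ?thesis
      using * scale_mult[OF assms, of "inverse c" c] by (simp add: scale_1 scale_0_right assms)
  qed simp
qed (use assms in \<open>auto simp: scale_0 scale_0_right\<close>)

text \<open>Monic polynomials of equal degree divide one another only if they are equal, so
  \<open>a\<close> reduces to a unit of the residue field and its action is invertible.\<close>

lemma drinfeld_injective_on_torsion:
  assumes "x \<in> T" "act (D a) x = 0" "Polynomial.lead_coeff a = 1" "Polynomial.degree a = m" "a \<noteq> p"
  shows "x = 0"
proof -
  have "\<not> p dvd a - 0"
  proof
    assume "p dvd a - 0"
    then obtain h where h: "a = p * h" by auto
    have nz: "p \<noteq> 0" "h \<noteq> 0"
      using assms(3) h by auto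
    hence "Polynomial.degree h = 0"
      using h assms(4) degree_p by (simp add: degree_mult_eq)
    then obtain c where c: "h = [:c:]"
      by (rule degree_eq_zeroE)
    have "c = 1"
      using assms(3) monic_p by (simp add: h c split: if_splits)
    thus False
      using assms(5) h c by simp
  qed
  hence "red a \<noteq> red 0"
    by (simp add: red_eq_iff)
  moreover have "red 0 = 0"
    using red_add[of 0 0] by (metis add.right_neutral add_left_imp_eq)
  ultimately have "red a \<noteq> 0"
    by simp
  moreover have "scale (red a) x = 0"
    using scale_eq[OF assms(1)] assms(2) by simp
  ultimately show ?thesis
    using scale_eq_0_iff[OF assms(1)] by simp
qed

section \<open>Coordinates, cosets and matrices\<close>

lemma \<beta>_in_T: "\<beta> k \<in> T"
  using \<beta>_basis by (simp add: torsion_basis_def)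

lemma comb_in_T: "comb c \<in> T"
  unfolding torsion_comb_def by (intro torsion_sum scale_in_T \<beta>_in_T)

lemma comb_add: "comb (c + d) = comb c + comb d"
  by (simp add: torsion_comb_def scale_add \<beta>_in_T sum.distrib)

lemma comb_0: "comb 0 = 0"
  by (simp add: torsion_comb_def scale_0 \<beta>_in_T)

lemma comb_scale: "comb (a *s c) = scale a (comb c)"
  by (simp add: torsion_comb_def scale_mult scale_sum_right scale_in_T \<beta>_in_T)

lemma comb_sum: "comb (\<Sum>i\<in>A. f i) = (\<Sum>i\<in>A. comb (f i))"
  by (induction A rule: infinite_finite_induct) (auto simp: comb_0 comb_add)

lemma ex1_comb: "x \<in> T \<Longrightarrow> \<exists>!c. comb c = x"
  using \<beta>_basis by (simp add: torsion_basis_def)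

lemma comb_eq_iff: "comb c = comb d \<longleftrightarrow> c = d"
  using ex1_comb[OF comb_in_T] by metis

lemma range_comb: "range comb = T"
  using ex1_comb comb_in_T by (metis image_subsetI rangeI subsetI subset_antisym)

lemma T_cases: assumes "x \<in> T" obtains c where "x = comb c"
  using assms range_comb by blast

lemma comb_coords: "x \<in> T \<Longrightarrow> comb (torsion_coords q \<iota> r p \<sigma> \<beta> x) = x"
  unfolding torsion_coords_def by (rule theI'[OF ex1_comb])

lemma card_T: "card T = q ^ (m * r)"
proof -
  have "card T = CARD('e ^ 'n)"
    unfolding range_comb[symmetric] by (rule card_image) (simp add: inj_on_def comb_eq_iff)
  thus ?thesis
    by (simp add: card_e r_def power_mult)
qed

lemma degree_Dp: "Polynomial.degree (D p) = m * r"
  using degree_drinfeld[OF monic_p] degree_p by simp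

text \<open>Divide \<open>F\<close> by \<open>D p\<close>: the remainder has degree below
  \<open>m * r\<close> and kills \<open>q ^ (m * r)\<close> points, so the root count forces it to
  vanish.\<close>

lemma kills_torsion_iff: "(\<forall>x\<in>T. act F x = 0) \<longleftrightarrow> (\<exists>H. F = H \<star> D p)"
proof
  assume F: "\<forall>x\<in>T. act F x = 0"
  obtain H S where HS: "F = H \<star> D p + S" "S = 0 \<or> Polynomial.degree S < Polynomial.degree (D p)"
    by (rule right_division[OF lead_coeff_drinfeld[OF monic_p]])
  have "S = 0"
  proof (rule kernel_card_imp_eq_0)
    show "T \<subseteq> {x. act S x = 0}"
      using F by (auto simp: HS tau_act_add act_mult torsion_iff)
    show "q ^ (m * r) \<le> card T"
      by (simp add: card_T)
    show "S = 0 \<or> Polynomial.degree S < m * r"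
      using HS(2) degree_Dp by simp
  qed
  thus "\<exists>H. F = H \<star> D p"
    using HS by auto
qed (auto simp: act_mult torsion_iff)

text \<open>Membership in the left ideal is annihilation of the torsion, so a coset is the same as a
  restriction to \<open>T\<close>. This makes the choice of representative in
  \<open>Theta_comp\<close> harmless.\<close>

lemma coset_eq: "coset u = {w. \<forall>x\<in>T. act w x = act u x}"
proof -
  have "w \<in> coset u \<longleftrightarrow> (\<exists>H. w - u = H \<star> D p)" for w
    by (auto simp: a_r_coset_def' cgenideal_def skew_ring_simps algebra_simps)
  also have "\<dots> w \<longleftrightarrow> (\<forall>x\<in>T. act w x = act u x)" for w
    by (simp add: tau_act_diff flip: kills_torsion_iff)
  finally show ?thesis by blast
qed

lemma coset_eq_iff: "coset u = coset w \<longleftrightarrow> (\<forall>x\<in>T. act u x = act w x)"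
  unfolding coset_eq by auto

lemma carrier_skew_quot: "carrier (skew_quot q (D p)) = range (\<lambda>u. coset u)"
  unfolding skew_quot_def FactRing_def A_RCOSETS_def' by (auto simp: skew_ring_simps)

text \<open>Column \<open>k\<close> holds the coordinates of the image of \<open>\<beta> k\<close>;
  the action is linear over \<open>'e\<close>, so agreement on the basis extends to all
  combinations.\<close>

lemma comb_mat: "comb (mat (coset u) *v c) = act u (comb c)"
proof -
  define w where "w = (SOME w. w \<in> coset u)"
  have "u \<in> coset u"
    by (simp add: coset_eq)
  hence "w \<in> coset u"
    unfolding w_def by (rule someI)
  hence w: "act w x = act u x" if "x \<in> T" for x
    using that by (simp add: coset_eq)
  define d where "d k = torsion_coords q \<iota> r p \<sigma> \<beta> (act u (\<beta> k))" for k
  have d: "comb (d k) = act u (\<beta> k)" for k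
    unfolding d_def by (intro comb_coords act_torsion \<beta>_in_T)
  have "mat (coset u) = (\<chi> i k. d k $ i)"
    unfolding Theta_comp_def w_def[symmetric] by (simp add: w \<beta>_in_T d_def)
  hence "mat (coset u) *v c = (\<Sum>k\<in>UNIV. c $ k *s d k)"
    by (simp add: matrix_vector_mult_def vec_eq_iff mult.commute)
  hence "comb (mat (coset u) *v c) = (\<Sum>k\<in>UNIV. scale (c $ k) (act u (\<beta> k)))"
    by (simp add: comb_sum comb_scale d)
  also have "\<dots> = act u (comb c)"
    by (simp add: torsion_comb_def act_sum_right act_scale_commute \<beta>_in_T)
  finally show ?thesis .
qed

lemma mat_coset_eq_iff: "mat (coset u) = mat (coset w) \<longleftrightarrow> (\<forall>x\<in>T. act u x = act w x)"
proof
  assume *: "mat (coset u) = mat (coset w)"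
  show "\<forall>x\<in>T. act u x = act w x"
  proof
    fix x assume "x \<in> T"
    then obtain c where "x = comb c" by (rule T_cases)
    thus "act u x = act w x"
      using comb_mat[of u c] comb_mat[of w c] * by simp
  qed
qed (metis coset_eq_iff)

end

section \<open>Several primes and the key equation\<close>

text \<open>Writing every row in a basis \<open>B\<close> of the row space leaves one scalar product
  per basis vector; \<open>g b\<close> collects the coefficients of \<open>b\<close> over all rows.
  The number of terms, \<open>rank A\<close>, controls both the size of the range and the number of
  conditions on the error locator.\<close>

lemma rank_factorization:
  fixes A :: "'a::field ^ 'n ^ 'm"
  obtains B :: "('a ^ 'n) set" and g :: "'a ^ 'n \<Rightarrow> 'a ^ 'm"
  where "finite B" "card B = rank A" "\<And>x. A *v x = (\<Sum>b\<in>B. (\<Sum>j\<in>UNIV. b $ j * x $ j) *s g b)"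
proof -
  obtain B where B: "B \<subseteq> rows A" "vec.independent B" "rows A \<subseteq> vec.span B" "card B = vec.dim (rows A)"
    by (rule vec.basis_exists)
  have fin: "finite B"
    by (rule vec.finiteI_independent[OF B(2)])
  have "\<exists>u. A $ i = (\<Sum>b\<in>B. u b *s b)" for i
  proof -
    have "A $ i \<in> vec.span B"
      using B(3) by (auto simp: rows_def row_def)
    thus ?thesis
      by (auto simp: vec.span_finite[OF fin])
  qed
  then obtain u where u: "\<And>i. A $ i = (\<Sum>b\<in>B. u i b *s b)"
    by metis
  show thesis
  proof (rule that[OF fin])
    show "card B = rank A"
      using B(4) by (simp add: row_rank_def_gen)
    fix x :: "'a ^ 'n"
    show "A *v x = (\<Sum>b\<in>B. (\<Sum>j\<in>UNIV. b $ j * x $ j) *s (\<chi> i. u i b))"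
    proof (subst vec_eq_iff, intro allI)
      fix i
      have "(A *v x) $ i = (\<Sum>j\<in>UNIV. \<Sum>b\<in>B. u i b * b $ j * x $ j)"
        by (simp add: matrix_vector_mult_def u sum_component sum_distrib_right)
      also have "\<dots> = (\<Sum>b\<in>B. \<Sum>j\<in>UNIV. u i b * b $ j * x $ j)"
        by (rule sum.swap)
      also have "\<dots> = (\<Sum>b\<in>B. (\<Sum>j\<in>UNIV. b $ j * x $ j) *s (\<chi> i. u i b)) $ i"
        by (simp add: sum_component sum_distrib_left mult_ac)
      finally show "(A *v x) $ i = (\<Sum>b\<in>B. (\<Sum>j\<in>UNIV. b $ j * x $ j) *s (\<chi> i. u i b)) $ i" .
    qed
  qed
qed

lemma card_range_matrix_le:
  fixes A :: "'a::{field,finite} ^ 'n ^ 'm"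
  shows "card (range ((*v) A)) \<le> CARD('a) ^ rank A"
proof -
  obtain B g where B: "finite B" "card B = rank A"
    "\<And>x. A *v x = (\<Sum>b\<in>B. (\<Sum>j\<in>UNIV. b $ j * x $ j) *s g b)"
    by (rule rank_factorization[of A]) blast
  have "A *v x \<in> (\<lambda>f. \<Sum>b\<in>B. f b *s g b) ` (B \<rightarrow>\<^sub>E UNIV)" for x
    by (rule image_eqI[of _ _ "\<lambda>b\<in>B. \<Sum>j\<in>UNIV. b $ j * x $ j"]) (auto simp: B(3))
  hence "card (range ((*v) A)) \<le> card ((\<lambda>f. \<Sum>b\<in>B. f b *s g b) ` (B \<rightarrow>\<^sub>E UNIV))"
    using B(1) by (intro card_mono finite_imageI finite_PiE) auto
  also have "\<dots> \<le> card (B \<rightarrow>\<^sub>E (UNIV :: 'a set))"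
    using B(1) by (intro card_image_le finite_PiE) auto
  finally show ?thesis
    using B(1,2) by (simp add: card_PiE)
qed

text \<open>Rank-nullity as a count: with a section \<open>s\<close> of the map, \<open>x\<close> is
  determined by \<open>A *v x\<close> and the kernel element \<open>x - s (A *v x)\<close>.\<close>

lemma card_kernel_matrix_ge:
  fixes A :: "'a::{field,finite} ^ 'n ^ 'm"
  shows "CARD('a ^ 'n) \<le> CARD('a) ^ rank A * card {x. A *v x = 0}"
proof -
  define s where "s y = (SOME x. A *v x = y)" for y
  have s: "A *v s (A *v x) = A *v x" for x
    unfolding s_def by (rule someI_ex) blast
  have "CARD('a ^ 'n) \<le> card (range ((*v) A) \<times> {x. A *v x = 0})"
  proof (rule card_inj_on_le)
    show "inj (\<lambda>x. (A *v x, x - s (A *v x)))"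
      by (rule injI) auto
  qed (auto simp: matrix_vector_mult_diff_distrib s)
  also have "\<dots> \<le> CARD('a) ^ rank A * card {x. A *v x = 0}"
    unfolding card_cartesian_product by (intro mult_right_mono card_range_matrix_le) simp
  finally show ?thesis .
qed

section \<open>Several primes: independent torsion and root counts\<close>

locale torsion_family = drinfeld_setting \<iota> q r
  for \<iota> :: "'f::finite_field \<Rightarrow> 'k::finite_field" and q r :: nat +
  fixes m l :: nat and \<qq> :: "nat \<Rightarrow> 'f poly" and \<sigma> :: "nat \<Rightarrow> 'f poly set \<Rightarrow> 'e::finite_field"
    and \<beta> :: "nat \<Rightarrow> 'n::finite \<Rightarrow> 'k alg_closure"
  assumes torsion_module: "\<And>i. i < l \<Longrightarrow> torsion_module \<iota> q r m (\<qq> i) (\<sigma> i) (\<beta> i)"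
    and inj_\<qq>: "inj_on \<qq> {..<l}"
begin

abbreviation T where "T i \<equiv> torsion q \<iota> r (\<qq> i)"
abbreviation comb where "comb i \<equiv> torsion_comb q \<iota> r (\<qq> i) (\<sigma> i) (\<beta> i)"
abbreviation Q where "Q i \<equiv> D (\<qq> i)"
abbreviation P where "P \<equiv> skew_prod q (\<lambda>i. Q i) l"
abbreviation encode where "encode u \<equiv> Theta q \<iota> r \<qq> l \<sigma> \<beta> (crt q (\<lambda>i. Q i) l u)"

text \<open>Applying \<open>Q i\<close> removes the summand in \<open>T i\<close> from the relation.
  By induction every remaining \<open>act (Q i) (x k)\<close> is zero, and \<open>Q i\<close> is
  injective on \<open>T k\<close> since the primes differ.\<close>

lemma torsion_independent:
  assumes "finite J" "J \<subseteq> {..<l}" "\<And>i. i \<in> J \<Longrightarrow> x i \<in> T i" "(\<Sum>i\<in>J. x i) = 0" "j \<in> J"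
  shows "x j = 0"
  using assms
proof (induction J arbitrary: x j rule: finite_induct)
  case (insert i J)
  interpret I: torsion_module \<iota> q r m "\<qq> i" "\<sigma> i" "\<beta> i"
    using insert.prems(1) by (intro torsion_module) auto
  have zero: "x k = 0" if "k \<in> J" for k
  proof -
    interpret K: torsion_module \<iota> q r m "\<qq> k" "\<sigma> k" "\<beta> k"
      using insert.prems(1) that by (intro torsion_module) auto
    have "act (Q i) (\<Sum>k\<in>insert i J. x k) = (\<Sum>k\<in>J. act (Q i) (x k))"
      using insert.hyps insert.prems(2)[of i] by (simp add: act_add_right act_sum_right torsion_iff)
    hence "(\<Sum>k\<in>J. act (Q i) (x k)) = 0"
      using insert.prems(3) by simp
    hence act_0: "act (Q i) (x k) = 0"
      using insert.prems(1,2) that by (intro insert.IH[of "\<lambda>k. act (Q i) (x k)" k]) (auto intro: act_torsion)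
    have neq: "\<qq> i \<noteq> \<qq> k"
      using inj_onD[OF inj_\<qq>, of i k] insert.prems(1) insert.hyps(2) that by auto
    have "x k \<in> T k"
      using that by (intro insert.prems(2)) simp
    thus "x k = 0"
      by (rule K.drinfeld_injective_on_torsion[OF _ act_0 I.monic_p I.degree_p neq])
  qed
  show ?case
  proof (cases "j = i")
    case True
    thus ?thesis
      using insert.prems(3) insert.hyps zero by simp
  qed (use zero insert.prems(4) in auto)
qed auto

text \<open>By independence, different choices of one element from each \<open>S i\<close> have
  different sums, and all these sums are roots of \<open>F\<close>.\<close>

lemma kernels_card_imp_eq_0:
  assumes S: "\<And>i. i < l \<Longrightarrow> S i \<subseteq> T i" "\<And>i x. i < l \<Longrightarrow> x \<in> S i \<Longrightarrow> act F x = 0"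
    and F: "F = 0 \<or> Polynomial.degree F < n" "q ^ n \<le> (\<Prod>i<l. card (S i))"
  shows "F = 0"
proof (rule kernel_card_imp_eq_0[OF _ _ F(1)])
  let ?sum = "\<lambda>f. \<Sum>i<l. f i"
  show "?sum ` (\<Pi>\<^sub>E i\<in>{..<l}. S i) \<subseteq> {x. act F x = 0}"
    using S(2) by (auto simp: act_sum_right PiE_def Pi_def)
  have "inj_on ?sum (\<Pi>\<^sub>E i\<in>{..<l}. S i)"
  proof (rule inj_onI)
    fix f g assume fg: "f \<in> (\<Pi>\<^sub>E i\<in>{..<l}. S i)" "g \<in> (\<Pi>\<^sub>E i\<in>{..<l}. S i)" "?sum f = ?sum g"
    show "f = g"
    proof (rule PiE_ext[OF fg(1,2)])
      fix i assume i: "i \<in> {..<l}"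
      have "f i - g i = 0"
      proof (rule torsion_independent[of "{..<l}" "\<lambda>i. f i - g i"])
        show "f k - g k \<in> T k" if "k \<in> {..<l}" for k
          using fg(1,2) S(1)[of k] that by (intro torsion_diff) (auto simp: PiE_def Pi_def)
        show "(\<Sum>i<l. f i - g i) = 0"
          using fg(3) by (simp add: sum_subtractf)
      qed (use i in auto)
      thus "f i = g i" by simp
    qed
  qed
  thus "q ^ n \<le> card (?sum ` (\<Pi>\<^sub>E i\<in>{..<l}. S i))"
    using F(2) by (simp add: card_image card_PiE)
qed

lemma kills_all_torsion_imp_eq_0:
  assumes "\<And>i x. i < l \<Longrightarrow> x \<in> T i \<Longrightarrow> act F x = 0" "F = 0 \<or> Polynomial.degree F < m * l * r"
  shows "F = 0"
proof (rule kernels_card_imp_eq_0[where S = T])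
  have "(\<Prod>i<l. card (T i)) = (\<Prod>i<l. q ^ (m * r))"
    by (intro prod.cong refl torsion_module.card_T[OF torsion_module]) auto
  thus "q ^ (m * l * r) \<le> (\<Prod>i<l. card (T i))"
    by (simp add: mult_ac flip: power_mult)
qed (use assms in auto)

lemma
  shows degree_P: "Polynomial.degree P = m * l * r"
    and lead_coeff_P: "Polynomial.lead_coeff P = 1"
    and act_P: "i < l \<Longrightarrow> x \<in> T i \<Longrightarrow> act P x = 0"
proof -
  let ?F = "\<lambda>xs. foldr (\<lambda>i F. Q i \<star> F) xs 1"
  have P: "P = ?F [0..<l]"
    by (simp add: skew_prod_def skew_ring_simps)
  \<comment> \<open>Arbitrary lists allow induction along \<open>foldr\<close>. The tail maps
    \<open>T j\<close> into itself before the head \<open>Q j\<close> kills it, and torsion of a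
    tail index is already gone, so no factors are interchanged.\<close>
  have F: "Polynomial.degree (?F xs) = length xs * (m * r) \<and> Polynomial.lead_coeff (?F xs) = 1 \<and>
      (i \<in> set xs \<longrightarrow> x \<in> T i \<longrightarrow> act (?F xs) x = 0)"
    if "set xs \<subseteq> {..<l}" for xs i x
    using that
  proof (induction xs)
    case (Cons j xs)
    interpret J: torsion_module \<iota> q r m "\<qq> j" "\<sigma> j" "\<beta> j"
      using Cons.prems by (intro torsion_module) auto
    have Qj: "Polynomial.lead_coeff (Q j) = 1"
      by (rule lead_coeff_drinfeld[OF J.monic_p])
    have nz: "Q j \<noteq> 0" "?F xs \<noteq> 0"
      using Qj Cons by auto
    have "act (Q j) (act (?F xs) x) = 0" if "x \<in> T j"
      using act_torsion[OF that] by (simp add: torsion_iff)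
    thus ?case
      using Cons degree_mult[OF nz] lead_coeff_mult[OF nz] Qj J.degree_Dp
      by (auto simp: act_mult)
  qed simp
  show "Polynomial.degree P = m * l * r" "Polynomial.lead_coeff P = 1"
    "i < l \<Longrightarrow> x \<in> T i \<Longrightarrow> act P x = 0"
    unfolding P using F[of "[0..<l]" i x] by (auto simp: atLeast0LessThan mult_ac)
qed

text \<open>The remainder modulo \<open>P\<close> still kills all torsion, but its degree is too
  small for a nonzero polynomial to do so.\<close>

lemma kills_all_torsion_imp_multiple:
  assumes "\<And>i x. i < l \<Longrightarrow> x \<in> T i \<Longrightarrow> act F x = 0"
  obtains H where "F = H \<star> P"
proof -
  obtain H S where HS: "F = H \<star> P + S" "S = 0 \<or> Polynomial.degree S < Polynomial.degree P"
    by (rule right_division[OF lead_coeff_P])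
  have "S = 0"
  proof (rule kills_all_torsion_imp_eq_0)
    fix i x assume "i < l" "x \<in> T i"
    thus "act S x = 0"
      using assms[of i x] act_P by (simp add: HS(1) tau_act_add act_mult)
  qed (use HS(2) degree_P in simp)
  thus thesis
    using that HS(1) by simp
qed

section \<open>Bijectivity of encoding, and the lift of a received word\<close>

lemma encode_eq_iff: "encode u = encode w \<longleftrightarrow> (\<forall>i<l. \<forall>x\<in>T i. act u x = act w x)"
proof -
  have "encode u = encode w \<longleftrightarrow> (\<forall>i<l. encode u i = encode w i)"
    by (auto simp: Theta_def fun_eq_iff)
  also have "\<dots> \<longleftrightarrow> (\<forall>i<l. \<forall>x\<in>T i. act u x = act w x)"
    by (auto simp: Theta_def crt_def torsion_module.mat_coset_eq_iff[OF torsion_module])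
  finally show ?thesis .
qed

lemma comb_encode: "i < l \<Longrightarrow> comb i (encode u i *v c) = act u (comb i c)"
  by (simp add: Theta_def crt_def torsion_module.comb_mat[OF torsion_module])

lemma encode_inj:
  assumes "encode u = encode w" "u = 0 \<or> Polynomial.degree u < m * l * r"
    "w = 0 \<or> Polynomial.degree w < m * l * r"
  shows "u = w"
proof -
  have "u - w = 0"
  proof (rule kills_all_torsion_imp_eq_0)
    show "act (u - w) x = 0" if "i < l" "x \<in> T i" for i x
      using assms(1) that by (simp add: tau_act_diff encode_eq_iff)
    show "u - w = 0 \<or> Polynomial.degree (u - w) < m * l * r"
      using assms(2,3) by (auto intro: degree_diff_less)
  qed
  thus ?thesis by simp
qed

text \<open>Polynomials with \<open>m * l * r\<close> coefficients from a field of
  \<open>q ^ r\<close> elements are as many as \<open>l\<close>-tuples of \<open>r\<close> by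
  \<open>r\<close> matrices over \<open>q ^ m\<close> elements, so injectivity suffices.\<close>

lemma encode_surj:
  assumes "l > 0" "M \<in> {..<l} \<rightarrow>\<^sub>E UNIV"
  obtains Y where "Y = 0 \<or> Polynomial.degree Y < m * l * r" "encode Y = M"
proof -
  let ?V = "{F :: 'k poly. \<forall>i\<ge>m * l * r. Polynomial.coeff F i = 0}"
  let ?W = "{..<l} \<rightarrow>\<^sub>E (UNIV :: ('e ^ 'n ^ 'n) set)"
  \<comment> \<open>The facts \<open>card_e\<close> and \<open>r_def\<close> come from the module at
    some index; \<open>l > 0\<close> provides index 0.\<close>
  interpret M: torsion_module \<iota> q r m "\<qq> 0" "\<sigma> 0" "\<beta> 0"
    using assms(1) by (rule torsion_module)
  have inj: "inj_on (\<lambda>u. encode u) ?V"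
    by (rule inj_onI) (auto simp: coeff_bounded_iff intro: encode_inj)
  have "card ?W = q ^ (m * r * r * l)"
    by (simp add: card_PiE M.card_e M.r_def flip: power_mult)
  also have "\<dots> = card ?V"
    by (simp add: card_coeff_bounded card_k mult_ac flip: power_mult)
  finally have "card ((\<lambda>u. encode u) ` ?V) = card ?W"
    by (simp add: card_image[OF inj])
  moreover have "(\<lambda>u. encode u) ` ?V \<subseteq> ?W"
    by (intro image_subsetI) (unfold Theta_def restrict_PiE_iff, simp)
  ultimately have "(\<lambda>u. encode u) ` ?V = ?W"
    by (intro card_subset_eq finite_PiE) auto
  then obtain Y where "Y \<in> ?V" "encode Y = M"
    using assms(2) by (metis (no_types, lifting) imageE)
  thus thesis
    using that by (simp add: coeff_bounded_iff)
qed

lemma crt_carrier_cases: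
  assumes "y \<in> crt_carrier q (\<lambda>i. Q i) l"
  obtains w where "y = (\<lambda>i\<in>{..<l}. PIdl\<^bsub>skew_ring q\<^esub> (Q i) +>\<^bsub>skew_ring q\<^esub> w i)"
proof -
  have "\<exists>w. y i = PIdl\<^bsub>skew_ring q\<^esub> (Q i) +>\<^bsub>skew_ring q\<^esub> w" if "i < l" for i
    using assms that torsion_module.carrier_skew_quot[OF torsion_module[OF that]]
    by (force simp: crt_carrier_def PiE_def Pi_def)
  then obtain w where w: "\<And>i. i < l \<Longrightarrow> y i = PIdl\<^bsub>skew_ring q\<^esub> (Q i) +>\<^bsub>skew_ring q\<^esub> w i"
    by metis
  have "y = (\<lambda>i\<in>{..<l}. PIdl\<^bsub>skew_ring q\<^esub> (Q i) +>\<^bsub>skew_ring q\<^esub> w i)"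
    using assms w by (auto simp: fun_eq_iff crt_carrier_def PiE_def extensional_def)
  thus thesis by (rule that)
qed

text \<open>This makes the \<open>inv_into\<close> of \<open>Theta_inv\<close> a genuine left
  inverse on tuples of cosets.\<close>

lemma Theta_inj_on: "inj_on (Theta q \<iota> r \<qq> l \<sigma> \<beta>) (crt_carrier q (\<lambda>i. Q i) l)"
proof (rule inj_onI)
  fix y z assume y: "y \<in> crt_carrier q (\<lambda>i. Q i) l" and z: "z \<in> crt_carrier q (\<lambda>i. Q i) l"
    and eq: "Theta q \<iota> r \<qq> l \<sigma> \<beta> y = Theta q \<iota> r \<qq> l \<sigma> \<beta> z"
  obtain w where w: "y = (\<lambda>i\<in>{..<l}. PIdl\<^bsub>skew_ring q\<^esub> (Q i) +>\<^bsub>skew_ring q\<^esub> w i)"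
    by (rule crt_carrier_cases[OF y])
  obtain w' where w': "z = (\<lambda>i\<in>{..<l}. PIdl\<^bsub>skew_ring q\<^esub> (Q i) +>\<^bsub>skew_ring q\<^esub> w' i)"
    by (rule crt_carrier_cases[OF z])
  have "y i = z i" if i: "i < l" for i
  proof -
    interpret I: torsion_module \<iota> q r m "\<qq> i" "\<sigma> i" "\<beta> i"
      by (rule torsion_module[OF i])
    have "I.mat (I.coset (w i)) = I.mat (I.coset (w' i))"
      using fun_cong[OF eq, of i] i by (simp add: Theta_def w w')
    thus ?thesis
      using i by (simp add: w w' I.mat_coset_eq_iff I.coset_eq_iff)
  qed
  thus "y = z"
    by (auto simp: w w' fun_eq_iff)
qed

text \<open>A preimage \<open>Y\<close> of small degree settles both descriptions: its residues are
  the value of \<open>Theta_inv\<close>, and injectivity of encoding makes it the polynomial singled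
  out by \<open>THE\<close>.\<close>

lemma crt_lift_Theta_inv:
  assumes "l > 0" "M \<in> {..<l} \<rightarrow>\<^sub>E UNIV"
  shows "encode (crt_lift q (\<lambda>i. Q i) l (Theta_inv q \<iota> r \<qq> l \<sigma> \<beta> M)) = M"
proof -
  obtain Y where Y: "Y = 0 \<or> Polynomial.degree Y < m * l * r" "encode Y = M"
    by (rule encode_surj[OF assms])
  have "crt q (\<lambda>i. Q i) l Y \<in> crt_carrier q (\<lambda>i. Q i) l"
    by (auto simp: crt_carrier_def crt_def torsion_module.carrier_skew_quot[OF torsion_module])
  hence inv: "Theta_inv q \<iota> r \<qq> l \<sigma> \<beta> M = crt q (\<lambda>i. Q i) l Y"
    unfolding Theta_inv_def Y(2)[symmetric] by (intro inv_into_f_f Theta_inj_on)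
  have P: "P \<noteq> 0"
    using lead_coeff_P by auto
  have "crt_lift q (\<lambda>i. Q i) l (crt q (\<lambda>i. Q i) l Y) = Y"
    unfolding crt_lift_def deg_tau_less_deg_tau_iff[OF P] degree_P
  proof (rule the_equality)
    fix Z assume "(Z = 0 \<or> Polynomial.degree Z < m * l * r) \<and>
      crt q (\<lambda>i. Q i) l Z = crt q (\<lambda>i. Q i) l Y"
    thus "Z = Y"
      using Y(1) by (intro encode_inj) simp_all
  qed (simp only: Y(1) simp_thms)
  thus ?thesis
    by (simp only: inv Y(2))
qed

section \<open>Existence and rigidity of solutions under a bounded error\<close>

context
  fixes u Y :: "'k poly" and E :: "nat \<Rightarrow> 'e ^ 'n ^ 'n" and \<epsilon> :: nat
  assumes error: "\<And>i c. i < l \<Longrightarrow> act (Y - u) (comb i c) = comb i (E i *v c)"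
    and weight: "sum_rank_weight l E \<le> \<epsilon>"
begin

text \<open>To kill the image of \<open>E i\<close> it suffices to kill the points
  \<open>comb i (g i b)\<close>, one for each basis vector in the rank factorization of
  \<open>E i\<close>.\<close>

lemma ex_error_locator:
  assumes "l > 0"
  obtains v where "v \<noteq> 0" "Polynomial.degree v \<le> m * \<epsilon>"
    "\<forall>i<l. \<forall>x\<in>T i. act v (act (Y - u) x) = 0"
proof -
  \<comment> \<open>Pairing the basis with its coefficient vectors lets a single choice serve all
    indices.\<close>
  define factors where "factors i Bg \<longleftrightarrow> finite (fst Bg) \<and> card (fst Bg) = rank (E i) \<and>
    (\<forall>x. E i *v x = (\<Sum>b\<in>fst Bg. (\<Sum>j\<in>UNIV. b $ j * x $ j) *s snd Bg b))" for i Bg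
  have "\<exists>Bg. factors i Bg" for i
  proof -
    obtain B and g where "finite B" "card B = rank (E i)"
      "\<And>x. E i *v x = (\<Sum>b\<in>B. (\<Sum>j\<in>UNIV. b $ j * x $ j) *s g b)"
      by (rule rank_factorization[of "E i"]) blast
    hence "factors i (B, g)"
      by (simp add: factors_def)
    thus ?thesis ..
  qed
  then obtain Bg where Bg: "\<And>i. factors i (Bg i)"
    by metis
  define B where "B i = fst (Bg i)" for i
  define g where "g i = snd (Bg i)" for i
  have B: "finite (B i)" "card (B i) = rank (E i)"
    "E i *v x = (\<Sum>b\<in>B i. (\<Sum>j\<in>UNIV. b $ j * x $ j) *s g i b)" for i x
    using Bg[of i] unfolding factors_def B_def g_def by blast+
  define I where "I = (SIGMA i:{..<l}. B i)"
  \<comment> \<open>Degree at most \<open>m * \<epsilon>\<close> leaves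
    \<open>m * \<epsilon> + 1\<close> coefficients; the extra one makes \<open>?V\<close> strictly
    larger than the space \<open>?W\<close> of possible values.\<close>
  let ?V = "{F :: 'k poly. \<forall>i\<ge>m * \<epsilon> + 1. Polynomial.coeff F i = 0}"
  let ?W = "\<Pi>\<^sub>E ib\<in>I. T (fst ib)"
  let ?h = "\<lambda>v. \<lambda>ib\<in>I. act v (comb (fst ib) (g (fst ib) (snd ib)))"
  have fin_I: "finite I"
    by (simp add: I_def B(1))
  have card_I: "card I \<le> \<epsilon>"
    using weight by (simp add: I_def B(1,2) sum_rank_weight_def)
  have card_T: "card (T (fst ib)) = q ^ (m * r)" if "ib \<in> I" for ib
    using that by (auto simp: I_def torsion_module.card_T[OF torsion_module])
  have "card ?W = (\<Prod>ib\<in>I. q ^ (m * r))"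
    using card_T by (simp add: card_PiE fin_I)
  also have "\<dots> = q ^ (m * r * card I)"
    by (simp add: power_mult)
  also have "\<dots> \<le> q ^ (m * r * \<epsilon>)"
    using q_pos card_I by (intro power_increasing) auto
  also have "\<dots> < q ^ (r * (m * \<epsilon> + 1))"
    using q_gt_1 r_pos by (intro power_strict_increasing) (auto simp: algebra_simps)
  also have "\<dots> = card ?V"
    unfolding card_coeff_bounded by (simp only: card_k power_mult)
  finally have less: "card ?W < card ?V" .
  have "finite ?W"
  proof (rule finite_PiE[OF fin_I])
    show "finite (T (fst ib))" if "ib \<in> I" for ib
      using card_T[OF that] q_pos by (metis card_gt_0_iff zero_less_power)
  qed
  moreover have "?h ` ?V \<subseteq> ?W"
  proof (intro image_subsetI restrict_PiE_iff[THEN iffD2] ballI act_torsion)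
    fix ib assume "ib \<in> I"
    hence "fst ib < l"
      by (auto simp: I_def)
    thus "comb (fst ib) (g (fst ib) (snd ib)) \<in> T (fst ib)"
      by (rule torsion_module.comb_in_T[OF torsion_module])
  qed
  ultimately have "card (?h ` ?V) < card ?V"
    using less card_mono[of ?W "?h ` ?V"] by linarith
  hence "\<not> inj_on ?h ?V"
    by (rule pigeonhole)
  then obtain v1 v2 where v: "v1 \<in> ?V" "v2 \<in> ?V" "?h v1 = ?h v2" "v1 \<noteq> v2"
    by (auto simp: inj_on_def)
  \<comment> \<open>Two candidates with the same values collide, and their difference is the
    locator.\<close>
  have kill: "act (v1 - v2) (comb i (g i b)) = 0" if "i < l" "b \<in> B i" for i b
    using fun_cong[OF v(3), of "(i, b)"] that by (simp add: I_def tau_act_diff)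
  show thesis
  proof (rule that[of "v1 - v2"])
    show "v1 - v2 \<noteq> 0"
      using v(4) by simp
    show "Polynomial.degree (v1 - v2) \<le> m * \<epsilon>"
      using v(1,2) by (intro degree_le) auto
    show "\<forall>i<l. \<forall>x\<in>T i. act (v1 - v2) (act (Y - u) x) = 0"
    proof (intro allI impI ballI)
      fix i x assume i: "i < l" and x: "x \<in> T i"
      interpret M: torsion_module \<iota> q r m "\<qq> i" "\<sigma> i" "\<beta> i"
        by (rule torsion_module[OF i])
      obtain c where c: "x = M.comb c"
        by (rule M.T_cases[OF x])
      show "act (v1 - v2) (act (Y - u) x) = 0"
        using kill i by (simp add: c error B(3) M.comb_sum M.comb_scale act_sum_right
            M.act_scale_commute M.comb_in_T M.scale_0_right)
    qed
  qed
qed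

text \<open>The slack \<open>m * \<epsilon>\<close> in the bound on \<open>n\<close> pays for the
  ranks of the error matrices: their kernels still supply \<open>q ^ n\<close> roots of
  \<open>N - v \<star> u\<close>.\<close>

lemma key_equation_imp_eq:
  assumes cong: "skew_cong q P (v \<star> Y) N"
    and deg: "N - v \<star> u = 0 \<or> Polynomial.degree (N - v \<star> u) < n" and n: "n + m * \<epsilon> \<le> m * l * r"
  shows "N = v \<star> u"
proof -
  obtain H where H: "v \<star> Y - N = H \<star> P"
    using cong by (auto simp: skew_cong_iff)
  define S where "S i = comb i ` {c. E i *v c = 0}" for i
  \<comment> \<open>\<open>P\<close> acts as zero on the torsion, so the congruence lets
    \<open>v \<star> Y\<close> replace \<open>N\<close> there.\<close>
  have act_W: "act (N - v \<star> u) x = act v (act (Y - u) x)" if "i < l" "x \<in> T i" for i x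
  proof -
    have "act (v \<star> Y - N) x = 0"
      using act_P[OF that] by (simp add: H act_mult)
    thus ?thesis
      by (simp add: tau_act_diff act_mult act_diff_right)
  qed
  have "N - v \<star> u = 0"
  proof (rule kernels_card_imp_eq_0[where S = S, OF _ _ deg])
    fix i assume i: "i < l"
    interpret M: torsion_module \<iota> q r m "\<qq> i" "\<sigma> i" "\<beta> i"
      by (rule torsion_module[OF i])
    show "S i \<subseteq> T i"
      by (auto simp: S_def M.comb_in_T)
    show "act (N - v \<star> u) x = 0" if "x \<in> S i" for x
      using that act_W[OF i] i by (auto simp: S_def M.comb_in_T error M.comb_0)
  next
    have card_S: "q ^ (m * r) \<le> q ^ (m * rank (E i)) * card (S i)" if i: "i < l" for i
    proof -
      interpret M: torsion_module \<iota> q r m "\<qq> i" "\<sigma> i" "\<beta> i"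
        by (rule torsion_module[OF i])
      have "card (S i) = card {c. E i *v c = 0}"
        unfolding S_def by (rule card_image) (simp add: inj_on_def M.comb_eq_iff)
      thus ?thesis
        using card_kernel_matrix_ge[of "E i"] by (simp add: M.card_e M.r_def flip: power_mult)
    qed
    \<comment> \<open>Rank-nullity at each index splits the torsion count into kernels and ranks;
      the weight bound then allows \<open>q ^ (m * \<epsilon>)\<close> to be cancelled.\<close>
    have "q ^ n * q ^ (m * \<epsilon>) \<le> q ^ (m * r * l)"
      unfolding power_add[symmetric] using n q_pos by (intro power_increasing) (auto simp: mult_ac)
    also have "\<dots> = (\<Prod>i<l. q ^ (m * r))"
      by (simp add: power_mult)
    also have "\<dots> \<le> (\<Prod>i<l. q ^ (m * rank (E i)) * card (S i))"
      using card_S by (intro prod_mono) auto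
    also have "\<dots> = q ^ (m * sum_rank_weight l E) * (\<Prod>i<l. card (S i))"
      by (simp add: prod.distrib sum_rank_weight_def sum_distrib_left power_sum)
    also have "\<dots> \<le> q ^ (m * \<epsilon>) * (\<Prod>i<l. card (S i))"
      using weight q_pos by (intro mult_right_mono power_increasing mult_left_mono) auto
    finally show "q ^ n \<le> (\<Prod>i<l. card (S i))"
      using q_pos by (simp add: mult.commute)
  qed
  thus ?thesis by simp
qed

end

end

section \<open>Decoding a received word by the key equation\<close>

theorem theorem4p8:
  fixes \<iota> :: "'f::finite_field \<Rightarrow> 'k::finite_field"
    and \<qq> :: "nat \<Rightarrow> 'f poly"
    and \<sigma> :: "nat \<Rightarrow> 'f poly set \<Rightarrow> 'e::finite_field"
    and \<beta> :: "nat \<Rightarrow> 'n::finite \<Rightarrow> 'k alg_closure"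
    and Q :: "nat \<Rightarrow> 'k poly"
    and P u Y :: "'k poly"
    and Cw Ew Yw :: "nat \<Rightarrow> 'e ^ 'n ^ 'n"
    and q r m l t K \<epsilon> :: nat
  assumes "q = CARD('f)" and "r = CARD('n)"
    and "r \<ge> 1" and "m \<ge> 1" and "l \<ge> 1"
    and "CARD('k) = q ^ r" and "\<iota> \<in> ring_hom type_ring type_ring"
    and "CARD('e) = q ^ m"
    and "\<And>i. i < l \<Longrightarrow> Polynomial.lead_coeff (\<qq> i) = 1"
    and "\<And>i. i < l \<Longrightarrow> Factorial_Ring.irreducible (\<qq> i)"
    and "\<And>i. i < l \<Longrightarrow> Polynomial.degree (\<qq> i) = m"
    and "\<And>i. i < l \<Longrightarrow> \<qq> i \<noteq> [:0, 1:]"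
    and "inj_on \<qq> {..<l}"
    and "\<And>i. i < l \<Longrightarrow> residue_iso (\<qq> i) (\<sigma> i)"
    and "\<And>i. i < l \<Longrightarrow> torsion_basis q \<iota> r (\<qq> i) (\<sigma> i) (\<beta> i)"
    and "Q = (\<lambda>i. drinfeld \<iota> r (\<qq> i))"
    and "P = skew_prod q Q l"
    and "1 \<le> t" and "t \<le> l * r" and "K = m * t"
    and "2 * \<epsilon> + t \<le> l * r"
    and "deg_tau u < ereal (real K)"
    and "Cw = Theta q \<iota> r \<qq> l \<sigma> \<beta> (crt q Q l u)"
    and "Ew \<in> {..<l} \<rightarrow>\<^sub>E UNIV" and "sum_rank_weight l Ew \<le> \<epsilon>"
    and "Yw = (\<lambda>i\<in>{..<l}. Cw i + Ew i)"
    and "Y = crt_lift q Q l (Theta_inv q \<iota> r \<qq> l \<sigma> \<beta> Yw)"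
  shows "deg_tau P = ereal (real (m * l * r)) \<and>
    (\<exists>v N. (v, N) \<noteq> (0, 0) \<and> key_equation q P Y m \<epsilon> K v N) \<and>
    (\<forall>v N. (v, N) \<noteq> (0, 0) \<and> key_equation q P Y m \<epsilon> K v N \<longrightarrow>
       N = v \<otimes>\<^bsub>skew_ring q\<^esub> u \<and> v \<noteq> 0 \<and>
       (\<forall>w D. is_left_division q N v w D \<longleftrightarrow> w = u \<and> D = 0))"
proof -
  interpret M: torsion_family \<iota> q r m l \<qq> \<sigma> \<beta>
  proof (intro torsion_family.intro drinfeld_setting.intro torsion_family_axioms.intro)
    show "torsion_module \<iota> q r m (\<qq> i) (\<sigma> i) (\<beta> i)" if "i < l" for i
      by unfold_locales (use assms(1-3,6-8) assms(9,11,14,15)[OF that] in auto)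
  qed (use assms(1-3,6,7,13) in auto)
  have l: "l > 0"
    using assms(5) by simp
  have P: "P = M.P" and encode_u: "Cw = M.encode u"
    using assms(16,17,23) by simp_all
  have encode_Y: "M.encode Y = Yw"
    unfolding assms(16,27) by (rule M.crt_lift_Theta_inv[OF l]) (simp add: assms(26))
  \<comment> \<open>\<open>Y\<close> acts through \<open>Cw i + Ew i\<close> and \<open>u\<close>
    through \<open>Cw i\<close>, so the difference acts through the error alone.\<close>
  have error: "M.act (Y - u) (M.comb i c) = M.comb i (Ew i *v c)" if i: "i < l" for i c
  proof -
    interpret I: torsion_module \<iota> q r m "\<qq> i" "\<sigma> i" "\<beta> i"
      by (rule M.torsion_module[OF i])
    have "M.act Y (M.comb i c) = M.comb i ((Cw i + Ew i) *v c)"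
      using M.comb_encode[OF i, of Y c] i unfolding encode_Y by (simp add: assms(26))
    moreover have "M.act u (M.comb i c) = M.comb i (Cw i *v c)"
      using M.comb_encode[OF i, of u c] unfolding encode_u by (rule sym)
    ultimately show ?thesis
      by (simp add: tau_act_diff matrix_vector_mult_add_rdistrib I.comb_add)
  qed
  have deg_u: "u = 0 \<or> Polynomial.degree u < K"
    using assms(22) by (simp add: deg_tau_less_iff)
  \<comment> \<open>This is \<open>m\<close> times the decoding radius condition, in the shape
    required for \<open>n = m * \<epsilon> + K\<close>.\<close>
  have bound: "(m * \<epsilon> + K) + m * \<epsilon> \<le> m * l * r"
    using mult_le_mono2[OF assms(21), of m] by (simp add: assms(20) algebra_simps)
  have key: "key_equation q P Y m \<epsilon> K v N \<longleftrightarrow> skew_cong q M.P (skew_mult q v Y) N \<and>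
      (v = 0 \<or> Polynomial.degree v \<le> m * \<epsilon>) \<and> (N = 0 \<or> Polynomial.degree N < m * \<epsilon> + K)" for v N
  proof -
    \<comment> \<open>The subtraction of 1 takes place in the reals, so nothing is truncated and the
      bound is a strict one between naturals.\<close>
    have "real a \<le> real (m * \<epsilon>) + real K - 1 \<longleftrightarrow> a < m * \<epsilon> + K" for a
      by linarith
    thus ?thesis
      by (simp only: key_equation_def deg_tau_le_iff P M.skew_ring_simps of_nat_le_iff)
  qed
  have deg_vu: "skew_mult q v u = 0 \<or> Polynomial.degree (skew_mult q v u) < m * \<epsilon> + K"
    if "v = 0 \<or> Polynomial.degree v \<le> m * \<epsilon>" for v
    using that deg_u M.degree_mult_le[of v u] by auto
  have deg_P: "deg_tau P = ereal (real (m * l * r))"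
    using M.degree_P M.lead_coeff_P by (auto simp: P deg_tau_def)
  obtain v where v: "v \<noteq> 0" "Polynomial.degree v \<le> m * \<epsilon>"
    "\<forall>i<l. \<forall>x\<in>M.T i. M.act v (M.act (Y - u) x) = 0"
    by (rule M.ex_error_locator[OF error assms(25) l])
  \<comment> \<open>The locator annihilates the error on all torsion; as a multiple of
    \<open>P\<close>, this product gives the congruence between \<open>v Y\<close> and
    \<open>v u\<close>.\<close>
  obtain H where H: "skew_mult q v (Y - u) = skew_mult q H M.P"
    by (rule M.kills_all_torsion_imp_multiple[of "skew_mult q v (Y - u)"]) (simp add: M.act_mult v(3))
  have "skew_cong q M.P (skew_mult q v Y) (skew_mult q v u)"
    unfolding M.skew_cong_iff using H by (auto simp: M.mult_diff_right)
  hence solvable: "key_equation q P Y m \<epsilon> K v (skew_mult q v u)"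
    using deg_vu[of v] v(2) by (auto simp: key)
  have solution: "N = skew_mult q v u \<and> v \<noteq> 0 \<and> (\<forall>w D. is_left_division q N v w D \<longleftrightarrow> w = u \<and> D = 0)"
    if nz: "(v, N) \<noteq> (0, 0)" and key_vN: "key_equation q P Y m \<epsilon> K v N" for v N
  proof -
    have deg: "v = 0 \<or> Polynomial.degree v \<le> m * \<epsilon>" "N = 0 \<or> Polynomial.degree N < m * \<epsilon> + K"
      and cong: "skew_cong q M.P (skew_mult q v Y) N"
      using key_vN by (auto simp: key)
    have "N - skew_mult q v u = 0 \<or> Polynomial.degree (N - skew_mult q v u) < m * \<epsilon> + K"
      using deg(2) deg_vu[OF deg(1)] by (auto intro: degree_diff_less)
    hence N: "N = skew_mult q v u"
      by (intro M.key_equation_imp_eq[OF _ assms(25) cong _ bound] error)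
    have v: "v \<noteq> 0"
      using nz N by auto
    have "is_left_division q N v w D \<longleftrightarrow> w = u \<and> D = 0" for w D
    proof
      assume *: "is_left_division q N v w D"
      hence D: "D = skew_mult q v (u - w)" and deg_D: "D = 0 \<or> Polynomial.degree D < Polynomial.degree v"
        using v by (simp_all add: is_left_division_def N M.skew_ring_simps M.mult_diff_right
            deg_tau_less_deg_tau_iff)
      \<comment> \<open>Degrees add, so a nonzero \<open>u - w\<close> would give
        \<open>D = v (u - w)\<close> at least the degree of \<open>v\<close>.\<close>
      have "u - w = 0"
        using deg_D M.mult_nonzero[OF v, of "u - w"] M.degree_mult[OF v, of "u - w"]
        unfolding D by fastforce
      thus "w = u \<and> D = 0"
        by (simp add: D)
    next
      assume "w = u \<and> D = 0"
      thus "is_left_division q N v w D"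
        using v by (simp add: is_left_division_def N M.skew_ring_simps deg_tau_less_deg_tau_iff)
    qed
    thus ?thesis
      using N v by blast
  qed
  have "(v, skew_mult q v u) \<noteq> (0, 0)"
    using v(1) by simp
  hence "\<exists>v N. (v, N) \<noteq> (0, 0) \<and> key_equation q P Y m \<epsilon> K v N"
    using solvable by blast
  thus ?thesis
    unfolding M.skew_ring_simps using deg_P solution by blast
qed

end
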